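(* Let $n$ and $m$ be nonnegative integers with $n\equiv 0,1,4,9 \pmod{12}$ and $m\equiv 0,1,4,9\pmod{12}$, and let $(X,\mathcal S)$ be any $3$-sun system of order $n$. Then $(X,\mathcal S)$ can be embedded in a $3$-sun system of order $m$ if and only if $m\geq \frac{7}{5}n+1$ or $m=n$.
   Context: A $3$-sun is the graph on six vertices $a,b,c,d,e,f$ with edges $\{a,b\},\{b,c\},\{c,a\},\{a,d\},\{b,e\},\{c,f\}$ (a triangle with three pendent edges forming a 1-factor). A $3$-sun system of order $n$ is a pair $(X,\mathcal S)$ where $|X|=n$ and $\mathcal S$ is a collection of subgraphs of the complete graph $K_n$ on $X$, each isomorphic to a $3$-sun, whose edge sets partition the edge set of $K_n$. (A $3$-sun system of order $n$ exists if and only if $n\equiv 0,1,4,9\pmod{12}$.) A $3$-sun system $(X_1,\mathcal S_1)$ is embedded in $(X_2,\mathcal S_2)$ if $X_1\subseteq X_2$ and $\mathcal S_1\subseteq\mathcal S_2$.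
   Formalization: The cases n = 0 or n = 1 with m = 4 are excluded: there the claim fails, because the trivial system of order 0 or 1 satisfies the bound but no 3-sun system of order 4 exists (a 3-sun has six vertices). *)

theory Defs
  imports Complex_Main "HOL-Library.Disjoint_Sets"
begin

text \<open>A simple graph is a pair of a vertex set and a set of two-element subsets of it.\<close>

type_synonym 'a ugraph = "'a set \<times> 'a set set"

abbreviation verts :: "'a ugraph \<Rightarrow> 'a set" where
  "verts G \<equiv> fst G"

abbreviation edges :: "'a ugraph \<Rightarrow> 'a set set" where
  "edges G \<equiv> snd G"

definition simple_graph :: "'a ugraph \<Rightarrow> bool" where
  "simple_graph G \<longleftrightarrow> (\<forall>e\<in>edges G. e \<subseteq> verts G \<and> card e = 2)"

definition subgraph_of :: "'a ugraph \<Rightarrow> 'a ugraph \<Rightarrow> bool" where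
  "subgraph_of H G \<longleftrightarrow> simple_graph H \<and> verts H \<subseteq> verts G \<and> edges H \<subseteq> edges G"

definition isomorphic :: "'a ugraph \<Rightarrow> 'b ugraph \<Rightarrow> bool" where
  "isomorphic G H \<longleftrightarrow>
    (\<exists>f. bij_betw f (verts G) (verts H) \<and> edges H = (\<lambda>e. f ` e) ` edges G)"

definition complete_graph :: "'a set \<Rightarrow> 'a ugraph" where
  "complete_graph X = (X, {e. e \<subseteq> X \<and> card e = 2})"

datatype sun_vertex = SA | SB | SC | SD | SE | SF

definition three_sun :: "sun_vertex ugraph" where
  "three_sun = ({SA, SB, SC, SD, SE, SF},
    {{SA, SB}, {SB, SC}, {SC, SA}, {SA, SD}, {SB, SE}, {SC, SF}})"

definition three_sun_system :: "nat \<Rightarrow> 'a set \<Rightarrow> 'a ugraph set \<Rightarrow> bool" where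
  "three_sun_system n X S \<longleftrightarrow>
    finite X \<and> card X = n \<and>
    (\<forall>G\<in>S. subgraph_of G (complete_graph X) \<and> isomorphic G three_sun) \<and>
    disjoint_family_on edges S \<and>
    (\<Union>G\<in>S. edges G) = edges (complete_graph X)"

definition embedded_in ::
    "'a set \<times> 'a ugraph set \<Rightarrow> 'a set \<times> 'a ugraph set \<Rightarrow> bool" where
  "embedded_in P Q \<longleftrightarrow> fst P \<subseteq> fst Q \<and> snd P \<subseteq> snd Q"

text \<open>
  The congruence condition alone does not guarantee existence: order 4 satisfies it, but a 3-sun
  has six vertices. The (unique) systems of orders 0 and 1 therefore do not embed in a system of
  order 4, although 4 exceeds the numerical bound.
\<close>

lemma no_three_sun_system_4: "\<not> three_sun_system 4 X S"
proof
  assume sys: "three_sun_system 4 X S"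
  then have X: "finite X" "card X = 4" by (auto simp: three_sun_system_def)
  obtain e where "e \<subseteq> X" "card e = 2"
    using obtain_subset_with_card_n[of 2 X] X by auto
  then have "e \<in> (\<Union>G\<in>S. edges G)"
    using sys by (simp add: three_sun_system_def complete_graph_def)
  then obtain G where "G \<in> S" by auto
  then have G: "verts G \<subseteq> X" "isomorphic G three_sun"
    using sys by (auto simp: three_sun_system_def subgraph_of_def complete_graph_def)
  then have "card (verts G) = card (verts three_sun)"
    by (auto simp: isomorphic_def dest: bij_betw_same_card)
  also have "\<dots> = 6" by (simp add: three_sun_def)
  finally show False
    using card_mono[OF X(1) G(1)] X(2) by simp
qed

end

theory Submission
  imports Defs
begin

text \<open>
  Necessity: a sun that uses no edge inside \<open>X\<close> has a triangle edge among the \<open>u = m - n\<close> new vertices,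
  so there are at most \<open>u choose 2\<close> new suns, and counting edges gives \<open>2 n + 5 \<le> 5 u\<close>.

  Sufficiency: identify the new vertices with the residues modulo \<open>u\<close> and split the edges among them by
  differences. One difference \<open>d\<close> and five vertices of \<open>X\<close> decompose into suns on the triangles
  \<open>{h, x, x + d}\<close> with \<open>h \<in> X\<close> prescribed by a colouring of the residues; this is the extremal
  configuration. Two differences also decompose with only four vertices of \<open>X\<close>, and four differences
  \<open>a, b, a + b, c\<close> with two vertices of \<open>X\<close>. A few special configurations account for the residue of the
  number of edges, which covers all \<open>m \<le> 2 n + 3\<close>. Larger \<open>m\<close> are reached through an intermediate
  order, starting from explicit systems of orders 9, 12 and 13.
\<close>

text \<open>Count in units of \<open>u\<close> edges: a difference below \<open>u / 2\<close> and
  the star of a hole vertex are one unit each, and \<open>u\<close> suns make six. The blocks with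
  one, two and four differences therefore leave room for five, four and two hole vertices. Replacing
  two one-difference blocks by a two-difference block saves \<open>u\<close> suns and six hole
  vertices; the four-difference block saves three times as much. With \<open>F\<close> differences,
  the number \<open>k\<close> in \<open>5 * F = n + 6 * k\<close> counts the savings to be made; for
  odd \<open>u\<close> without a special configuration \<open>k = 0\<close> is the case of equality
  in the bound.

  Two obstacles shape the rest. The number of suns need not be a multiple of \<open>u\<close>, so
  some configurations must consist of a multiple of \<open>u / 3\<close>, \<open>u / 4\<close> or
  \<open>u / 12\<close> suns, or treat difference \<open>u / 2\<close>, whose circulant has only
  \<open>u / 2\<close> edges. And a difference of order 5 modulo \<open>u\<close> splits the
  residues into 5-cycles; vertices at distance 1 or 2 must get different colours, which on a 5-cycle
  needs five colours instead of four.\<close>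

definition sun_edges :: "'v \<Rightarrow> 'v \<Rightarrow> 'v \<Rightarrow> 'v \<Rightarrow> 'v \<Rightarrow> 'v \<Rightarrow> 'v set set" where
  "sun_edges a b c d e f = {{a, b}, {b, c}, {c, a}, {a, d}, {b, e}, {c, f}}"

definition is_sun :: "'v set set \<Rightarrow> bool" where
  "is_sun P \<longleftrightarrow> (\<exists>a b c d e f. distinct [a, b, c, d, e, f] \<and> P = sun_edges a b c d e f)"

definition sun_cover :: "'v set set \<Rightarrow> nat \<Rightarrow> bool" where
  "sun_cover E N \<longleftrightarrow>
    (\<exists>Q. finite Q \<and> card Q \<le> N \<and> (\<forall>P\<in>Q. is_sun P) \<and> E \<subseteq> \<Union>Q)"

section \<open>Suns as edge sets, and covers by suns\<close>

lemma is_sunI: "distinct [a, b, c, d, e, f] \<Longrightarrow> is_sun (sun_edges a b c d e f)"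
  unfolding is_sun_def by blast

lemma card_sun_edges:
  assumes "distinct [a, b, c, d, e, f]"
  shows "card (sun_edges a b c d e f) = 6"
  using assms by (auto simp: sun_edges_def doubleton_eq_iff card_insert_if)

lemma is_sun_card: "is_sun P \<Longrightarrow> card P = 6"
  unfolding is_sun_def using card_sun_edges by metis

lemma is_sun_finite: "is_sun P \<Longrightarrow> finite P"
  using is_sun_card card.infinite by fastforce

lemma is_sun_edge_card: "is_sun P \<Longrightarrow> e \<in> P \<Longrightarrow> card e = 2"
  by (auto simp: is_sun_def sun_edges_def)

lemma is_sun_image:
  assumes "is_sun P" "inj_on f (\<Union>P)"
  shows "is_sun ((`) f ` P)"
proof -
  obtain a b c d e g where d: "distinct [a, b, c, d, e, g]" and P: "P = sun_edges a b c d e g"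
    using assms(1) unfolding is_sun_def by blast
  have "distinct (map f [a, b, c, d, e, g])"
    using d assms(2) unfolding P by (subst distinct_map) (auto simp: sun_edges_def inj_on_def)
  moreover have "(`) f ` P = sun_edges (f a) (f b) (f c) (f d) (f e) (f g)"
    unfolding P sun_edges_def by simp
  ultimately show ?thesis using is_sunI by simp
qed

lemma sun_coverI:
  "finite Q \<Longrightarrow> card Q \<le> N \<Longrightarrow> (\<And>P. P \<in> Q \<Longrightarrow> is_sun P) \<Longrightarrow> E \<subseteq> \<Union>Q \<Longrightarrow> sun_cover E N"
  unfolding sun_cover_def by blast

lemma sun_cover_empty: "sun_cover {} 0"
  by (rule sun_coverI[of "{}"]) auto

lemma sun_cover_mono: "sun_cover E N \<Longrightarrow> E' \<subseteq> E \<Longrightarrow> N \<le> N' \<Longrightarrow> sun_cover E' N'"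
  unfolding sun_cover_def by (meson order_trans)

lemma sun_cover_Un:
  assumes "sun_cover E N" "sun_cover E' N'"
  shows "sun_cover (E \<union> E') (N + N')"
proof -
  obtain Q Q' where "finite Q" "card Q \<le> N" "\<forall>P\<in>Q. is_sun P" "E \<subseteq> \<Union>Q"
    "finite Q'" "card Q' \<le> N'" "\<forall>P\<in>Q'. is_sun P" "E' \<subseteq> \<Union>Q'"
    using assms unfolding sun_cover_def by metis
  then show ?thesis
    by (intro sun_coverI[of "Q \<union> Q'"])
      (auto intro: order_trans[OF card_Un_le] add_mono)
qed

lemma sun_cover_UN:
  assumes "finite I" "\<And>i. i \<in> I \<Longrightarrow> sun_cover (E i) N"
  shows "sun_cover (\<Union>i\<in>I. E i) (card I * N)"
  using assms
proof (induction I rule: finite_induct)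
  case empty
  then show ?case by (simp add: sun_cover_empty)
next
  case (insert i I)
  then show ?case using sun_cover_Un[of "E i" N "\<Union>i\<in>I. E i" "card I * N"] by simp
qed

lemma sun_cover_family:
  assumes "finite I" "card I \<le> N" "\<And>i. i \<in> I \<Longrightarrow> is_sun (B i)" "E \<subseteq> (\<Union>i\<in>I. B i)"
  shows "sun_cover E N"
  using assms by (intro sun_coverI[of "B ` I"]) (auto intro: order_trans[OF card_image_le])

text \<open>A cover that is as small as the number of edges permits is automatically a partition, so
  disjointness of the suns never has to be checked.\<close>

lemma sun_cover_partition:
  assumes "sun_cover E N" "finite E" "6 * N \<le> card E"
  obtains Q where "finite Q" "card Q = N" "\<And>P. P \<in> Q \<Longrightarrow> is_sun P" "disjoint Q" "\<Union>Q = E"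
proof -
  obtain Q where Q: "finite Q" "card Q \<le> N" "\<And>P. P \<in> Q \<Longrightarrow> is_sun P" "E \<subseteq> \<Union>Q"
    using assms(1) unfolding sun_cover_def by metis
  have fin: "finite (\<Union>Q)" using Q is_sun_finite by blast
  have sum: "(\<Sum>P\<in>Q. card P) = 6 * card Q"
    using sum.cong[OF refl is_sun_card[OF Q(3)], of Q] by simp
  have le: "card (\<Union>Q) \<le> (\<Sum>P\<in>Q. card P)"
    using card_Union_le_sum_card by blast
  have "card E \<le> card (\<Union>Q)" using Q(4) fin by (simp add: card_mono)
  then have eq: "card (\<Union>Q) = card E" "card Q = N" and sumeq: "card (\<Union>Q) = (\<Sum>P\<in>Q. card P)"
    using le sum Q(2) assms(3) by auto
  have "E = \<Union>Q" using eq(1) Q(4) fin card_subset_eq by metis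
  moreover have "disjoint Q"
  proof (rule disjointI)
    fix A B assume AB: "A \<in> Q" "B \<in> Q" "A \<noteq> B"
    have "\<Union>Q = (A \<union> B) \<union> \<Union>(Q - {A, B})" using AB by auto
    then have "card (\<Union>Q) \<le> card (A \<union> B) + card (\<Union>(Q - {A, B}))"
      using card_Un_le by metis
    also have "card (\<Union>(Q - {A, B})) \<le> (\<Sum>P\<in>Q - {A, B}. card P)"
      using card_Union_le_sum_card by blast
    finally have "(\<Sum>P\<in>Q. card P) \<le> card (A \<union> B) + (\<Sum>P\<in>Q - {A, B}. card P)"
      using sumeq by simp
    moreover have "(\<Sum>P\<in>Q. card P) = (\<Sum>P\<in>Q - {A, B}. card P) + (card A + card B)"
      using AB Q(1) sum.subset_diff[of "{A, B}" Q card] by simp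
    ultimately have "card A + card B \<le> card (A \<union> B)" by simp
    moreover have "finite A" "finite B" using AB Q(3) is_sun_finite by auto
    ultimately have "card (A \<inter> B) = 0" using card_Un_Int[of A B] by linarith
    then show "A \<inter> B = {}" using \<open>finite A\<close> by simp
  qed
  ultimately show thesis using that[of Q] Q eq by simp
qed

section \<open>Suns as edge sets against suns as subgraphs\<close>

lemma is_sun_isomorphic:
  assumes "is_sun P"
  shows "isomorphic (\<Union>P, P) three_sun"
proof -
  obtain a b c d e g where d: "distinct [a, b, c, d, e, g]" and P: "P = sun_edges a b c d e g"
    using assms unfolding is_sun_def by blast
  define f where "f = (\<lambda>x. if x = a then SA else if x = b then SB else if x = c then SC
      else if x = d then SD else if x = e then SE else SF)"
  have f: "f a = SA" "f b = SB" "f c = SC" "f d = SD" "f e = SE" "f g = SF"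
    using d by (auto simp: f_def)
  have U: "\<Union>P = {a, b, c, d, e, g}" by (auto simp: P sun_edges_def)
  have "bij_betw f (\<Union>P) {SA, SB, SC, SD, SE, SF}"
    unfolding bij_betw_def U inj_on_def using f by auto
  moreover have "{{SA, SB}, {SB, SC}, {SC, SA}, {SA, SD}, {SB, SE}, {SC, SF}} = (`) f ` P"
    unfolding P sun_edges_def by (simp add: f)
  ultimately show ?thesis
    unfolding isomorphic_def three_sun_def by (auto intro!: exI[of _ f])
qed

lemma isomorphic_is_sun:
  assumes "isomorphic G three_sun" "\<Union>(edges G) \<subseteq> verts G"
  shows "is_sun (edges G)"
proof -
  obtain f where f: "bij_betw f (verts G) (verts three_sun)"
    "edges three_sun = (`) f ` edges G"
    using assms unfolding isomorphic_def by blast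
  let ?g = "inv_into (verts G) f"
  have inj: "inj_on ?g (verts three_sun)"
    using f(1) by (simp add: bij_betw_def inj_on_inv_into)
  have "?g ` (f ` e) = e" if "e \<in> edges G" for e
    using that assms(2) f(1) bij_betw_imp_inj_on inv_into_image_cancel by (metis Sup_le_iff)
  then have "edges G = (`) ?g ` edges three_sun"
    unfolding f(2) image_image by simp
  moreover have "is_sun (edges three_sun)"
    using is_sunI[of SA SB SC SD SE SF] by (simp add: three_sun_def sun_edges_def)
  moreover have "\<Union>(edges three_sun) \<subseteq> verts three_sun"
    by (auto simp: three_sun_def)
  ultimately show ?thesis
    using is_sun_image inj inj_on_subset by metis
qed

lemma three_sun_system_is_sun:
  assumes "three_sun_system n X S" "G \<in> S"
  shows "is_sun (edges G)" "verts G \<subseteq> X"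
proof -
  have "subgraph_of G (complete_graph X)" "isomorphic G three_sun"
    using assms unfolding three_sun_system_def by auto
  then show "is_sun (edges G)" "verts G \<subseteq> X"
    by (auto intro!: isomorphic_is_sun simp: subgraph_of_def simple_graph_def complete_graph_def)
qed

section \<open>Extending a system of suns\<close>

text \<open>The complete graph on \<open>V\<close> with a hole at \<open>W\<close>: its
  decompositions into suns are what a system on \<open>W\<close> lacks to become a system on
  \<open>V\<close>.\<close>

definition hole_graph :: "'v set \<Rightarrow> 'v set \<Rightarrow> 'v set set" where
  "hole_graph V W = {e. e \<subseteq> V \<and> card e = 2 \<and> \<not> e \<subseteq> W}"

lemma finite_hole_graph: "finite V \<Longrightarrow> finite (hole_graph V W)"
  unfolding hole_graph_def by simp

lemma card_hole_graph:
  assumes "finite V" "W \<subseteq> V"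
  shows "card (hole_graph V W) + (card W choose 2) = card V choose 2"
proof -
  have W: "finite W" using assms finite_subset by blast
  have "{e. e \<subseteq> V \<and> card e = 2} = hole_graph V W \<union> {e. e \<subseteq> W \<and> card e = 2}"
    using assms(2) unfolding hole_graph_def by auto
  moreover have "hole_graph V W \<inter> {e. e \<subseteq> W \<and> card e = 2} = {}"
    unfolding hole_graph_def by auto
  ultimately have "card {e. e \<subseteq> V \<and> card e = 2} = card (hole_graph V W) + card {e. e \<subseteq> W \<and> card
      e = 2}"
    using assms W finite_hole_graph[of V W] card_Un_disjoint[of "hole_graph V W" "{e. e \<subseteq> W \<and>
        card e = 2}"]
    by simp
  then show ?thesis using n_subsets[OF assms(1), of 2] n_subsets[OF W, of 2] by simp
qed

lemma image_hole_graph: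
  assumes "bij_betw f V V'" "f ` W = W'" "W \<subseteq> V"
  shows "(`) f ` hole_graph V W = hole_graph V' W'"
proof (intro equalityI subsetI)
  have inj: "inj_on f V" and im: "f ` V = V'" using assms(1) by (auto simp: bij_betw_def)
  fix e assume "e \<in> (`) f ` hole_graph V W"
  then obtain d where d: "e = f ` d" "d \<subseteq> V" "card d = 2" "\<not> d \<subseteq> W"
    unfolding hole_graph_def by auto
  have "card e = 2" using d inj by (metis card_image inj_on_subset)
  moreover have "\<not> e \<subseteq> W'"
  proof -
    obtain x where "x \<in> d" "x \<notin> W" using d(4) by auto
    then have "f x \<in> e" "f x \<notin> f ` W"
      using d(1,2) inj_on_image_mem_iff[OF inj _ assms(3), of x] by auto
    then show ?thesis unfolding assms(2) by auto
  qed
  ultimately show "e \<in> hole_graph V' W'"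
    using d im unfolding hole_graph_def by auto
next
  have inj: "inj_on f V" and im: "f ` V = V'" using assms(1) by (auto simp: bij_betw_def)
  fix e assume e: "e \<in> hole_graph V' W'"
  then have "e \<subseteq> f ` V" using im unfolding hole_graph_def by auto
  then obtain d where d: "d \<subseteq> V" "e = f ` d" by (meson subset_imageE)
  have "card d = 2" using e d inj unfolding hole_graph_def
    by (metis (mono_tags, lifting) card_image inj_on_subset mem_Collect_eq)
  moreover have "\<not> d \<subseteq> W" using e d assms(2) unfolding hole_graph_def by auto
  ultimately show "e \<in> (`) f ` hole_graph V W" using d unfolding hole_graph_def by auto
qed

text \<open>A sun has no isolated vertex, so its edge set \<open>P\<close> determines the graph
  \<open>(\<Union>P, P)\<close>. Disjointness between old and new suns is automatic: edges of old
  suns stay inside \<open>X\<close>, edges of new ones do not.\<close>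

lemma three_sun_system_extend:
  fixes X :: "'a set"
  assumes sys: "three_sun_system n X S" and X': "X \<subseteq> X'" "finite X'"
    and Q: "\<And>P. P \<in> Q \<Longrightarrow> is_sun P" "disjoint Q" "\<Union>Q = hole_graph X' X"
  shows "three_sun_system (card X') X' (S \<union> (\<lambda>P. (\<Union>P, P)) ` Q)"
proof -
  have S: "\<And>G. G \<in> S \<Longrightarrow> subgraph_of G (complete_graph X) \<and> isomorphic G three_sun"
    "disjoint_family_on edges S" "(\<Union>G\<in>S. edges G) = {e. e \<subseteq> X \<and> card e = 2}"
    using sys unfolding three_sun_system_def complete_graph_def by auto
  have new: "e \<subseteq> X' \<and> card e = 2 \<and> \<not> e \<subseteq> X" if "P \<in> Q" "e \<in> P" for P e
  proof -
    have "e \<in> hole_graph X' X" unfolding Q(3)[symmetric] using that by blast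
    then show ?thesis unfolding hole_graph_def by simp
  qed
  have old: "e \<subseteq> X" if "G \<in> S" "e \<in> edges G" for G e
    using S(3) that by blast
  let ?S = "S \<union> (\<lambda>P. (\<Union>P, P)) ` Q"
  have "subgraph_of G (complete_graph X') \<and> isomorphic G three_sun" if "G \<in> ?S" for G
    using that
  proof
    assume "G \<in> S"
    then show ?thesis using S(1)[of G] X' unfolding subgraph_of_def complete_graph_def by auto
  next
    assume "G \<in> (\<lambda>P. (\<Union>P, P)) ` Q"
    then obtain P where P: "P \<in> Q" "G = (\<Union>P, P)" by auto
    then show ?thesis using new[OF P(1)] is_sun_isomorphic[OF Q(1)[OF P(1)]]
      unfolding subgraph_of_def complete_graph_def simple_graph_def by auto
  qed
  moreover have "disjoint_family_on edges ?S"
    unfolding disjoint_family_on_def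
  proof (intro ballI impI)
    fix G H assume GH: "G \<in> ?S" "H \<in> ?S" "G \<noteq> H"
    have cases: "K \<in> S \<or> edges K \<in> Q \<and> K = (\<Union>(edges K), edges K)" if "K \<in> ?S" for K
      using that by auto
    consider "G \<in> S" "H \<in> S" | "G \<in> S" "edges H \<in> Q" | "edges G \<in> Q" "H \<in> S"
      | "edges G \<in> Q" "edges H \<in> Q" "edges G \<noteq> edges H"
      using cases[OF GH(1)] cases[OF GH(2)] GH(3) by metis
    then show "edges G \<inter> edges H = {}"
    proof cases
      case 1
      then show ?thesis using S(2) GH(3) unfolding disjoint_family_on_def by auto
    next
      case 2
      then show ?thesis using new[of "edges H"] old[of G] by blast
    next
      case 3
      then show ?thesis using new[of "edges G"] old[of H] by blast
    next
      case 4
      then show ?thesis using Q(2) unfolding disjoint_def by auto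
    qed
  qed
  moreover have "(\<Union>G\<in>?S. edges G) = {e. e \<subseteq> X' \<and> card e = 2}"
  proof -
    have "(\<Union>G\<in>?S. edges G) = {e. e \<subseteq> X \<and> card e = 2} \<union> \<Union>Q" using S(3) by auto
    also have "\<dots> = {e. e \<subseteq> X' \<and> card e = 2}" unfolding Q(3) hole_graph_def using X' by auto
    finally show ?thesis .
  qed
  ultimately show ?thesis using X' unfolding three_sun_system_def complete_graph_def by auto
qed

text \<open>Quantifying over all systems of order \<open>n\<close> makes the relation transitive, so
  that extensions can be chained through intermediate orders. The last argument only fixes the
  vertex type.\<close>

definition extendable :: "nat \<Rightarrow> nat \<Rightarrow> 'a itself \<Rightarrow> bool" where
  "extendable n m T \<longleftrightarrow> (\<forall>(X :: 'a set) S. three_sun_system n X S \<longrightarrow>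
    (\<exists>X' S'. three_sun_system m X' S' \<and> embedded_in (X, S) (X', S')))"

lemma extendable_refl: "extendable n n T"
  unfolding extendable_def embedded_in_def by auto

lemma extendable_trans: "extendable n k T \<Longrightarrow> extendable k m T \<Longrightarrow> extendable n m T"
  unfolding extendable_def embedded_in_def fst_conv snd_conv by (meson subset_trans)

text \<open>Only the orders matter: a cover found on convenient vertices is carried over by a
  bijection that sends \<open>W\<close> to the given \<open>X\<close> and the other vertices to
  fresh elements, which an infinite type supplies. The inequality on \<open>N\<close> says that the
  cover is as small as the number of edges permits, hence a partition.\<close>

lemma extendable_cover:
  fixes V W :: "'v set"
  assumes inf: "infinite (UNIV :: 'a set)"
    and V: "finite V" "W \<subseteq> V" "card W = n" "card V = m"
    and cov: "sun_cover (hole_graph V W) N" "6 * N + (n choose 2) \<le> m choose 2"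
  shows "extendable n m TYPE('a)"
  unfolding extendable_def
proof (intro allI impI)
  fix X :: "'a set" and S
  assume sys: "three_sun_system n X S"
  then have X: "finite X" "card X = n" unfolding three_sun_system_def by auto
  have W: "finite W" using V finite_subset by blast
  obtain Z where Z: "Z \<subseteq> - X" "finite Z" "card Z = m - n"
    using infinite_arbitrarily_large[of "- X" "m - n"] inf X(1) by (auto simp: Compl_eq_Diff_UNIV)
  obtain f where f: "bij_betw f W X" using finite_same_card_bij[OF W X(1)] V X by auto
  have "card (V - W) = card Z" using V W Z by (simp add: card_Diff_subset)
  then obtain g where g: "bij_betw g (V - W) Z"
    using finite_same_card_bij[of "V - W" Z] V Z by auto
  define h where "h x = (if x \<in> W then f x else g x)" for x
  have "bij_betw h W X" "bij_betw h (V - W) Z"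
    using f g bij_betw_cong[of W h f X] bij_betw_cong[of "V - W" h g Z] by (auto simp: h_def)
  then have "bij_betw h (W \<union> (V - W)) (X \<union> Z)"
    using Z(1) by (intro bij_betw_combine) auto
  then have h: "bij_betw h V (X \<union> Z)" using V by (simp add: Un_absorb1)
  have hW: "h ` W = X" using \<open>bij_betw h W X\<close> by (simp add: bij_betw_def)
  have "6 * N \<le> card (hole_graph V W)" using card_hole_graph[OF V(1,2)] cov V by simp
  then obtain Q where Q: "\<And>P. P \<in> Q \<Longrightarrow> is_sun P" "disjoint Q" "\<Union>Q = hole_graph V W"
    using sun_cover_partition[OF cov(1) finite_hole_graph[OF V(1)]] by metis
  let ?h = "(`) ((`) h)"
  have sub: "\<Union>(\<Union>Q) \<subseteq> V" unfolding Q(3) hole_graph_def by auto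
  have injV: "inj_on h V" using h by (simp add: bij_betw_def)
  then have inj: "inj_on ((`) h) (\<Union>Q)"
    using sub by (intro inj_on_image) (auto intro: inj_on_subset)
  have "is_sun P" if P: "P \<in> ?h ` Q" for P
  proof -
    obtain P0 where "P0 \<in> Q" "P = (`) h ` P0" using P by auto
    moreover from this have "inj_on h (\<Union>P0)"
      using sub by (intro inj_on_subset[OF injV]) blast
    ultimately show ?thesis using Q(1) is_sun_image[of P0 h] by simp
  qed
  moreover have "disjoint (?h ` Q)"
  proof (rule disjointI)
    fix A B assume "A \<in> ?h ` Q" "B \<in> ?h ` Q" "A \<noteq> B"
    then obtain A0 B0 where "A0 \<in> Q" "B0 \<in> Q" "A = (`) h ` A0" "B = (`) h ` B0" "A0 \<noteq> B0"
      by (elim imageE) metis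
    moreover from this have "A0 \<inter> B0 = {}" using Q(2) unfolding disjoint_def by auto
    ultimately show "A \<inter> B = {}"
      using inj_on_image_Int[OF inj, of A0 B0] by (metis Union_upper image_empty)
  qed
  moreover have "\<Union>(?h ` Q) = hole_graph (X \<union> Z) X"
    using image_hole_graph[OF h hW V(2)] Q(3) by (metis image_Union)
  ultimately have "three_sun_system (card (X \<union> Z)) (X \<union> Z) (S \<union> (\<lambda>P. (\<Union>P, P)) ` (?h ` Q))"
    using Z X by (intro three_sun_system_extend[OF sys]) auto
  moreover have "card (X \<union> Z) = m" using bij_betw_same_card[OF h] V by simp
  ultimately show "\<exists>X' S'. three_sun_system m X' S' \<and> embedded_in (X, S) (X', S')"
    unfolding embedded_in_def fst_conv snd_conv by (intro exI conjI, simp only:) (rule sup_ge1)+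
qed

section \<open>Necessity of the bound\<close>

lemma three_sun_system_bound:
  assumes sys: "three_sun_system n X S" "three_sun_system m X' S'"
    and emb: "embedded_in (X, S) (X', S')" and "m \<noteq> n"
  shows "7 * n + 5 \<le> 5 * m"
proof -
  have X: "X \<subseteq> X'" "finite X" "card X = n" "finite X'" "card X' = m" and S: "S \<subseteq> S'"
    using sys emb unfolding three_sun_system_def embedded_in_def by auto
  have lt: "n < m" using X assms(4) card_mono[of X' X] by auto
  let ?U = "X' - X"
  have U: "card ?U = m - n" using X by (simp add: card_Diff_subset)
  have Su: "(\<Union>G\<in>S. edges G) = {e. e \<subseteq> X \<and> card e = 2}" "(\<Union>G\<in>S'. edges G) = {e. e \<subseteq> X' \<and> card e = 2}"
    "disjoint_family_on edges S'"
    using sys unfolding three_sun_system_def complete_graph_def by auto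
  define R where "R = S' - S"
  have un: "hole_graph X' X \<subseteq> (\<Union>G\<in>R. edges G)"
  proof
    fix e assume e: "e \<in> hole_graph X' X"
    then have "e \<in> (\<Union>G\<in>S'. edges G)" "e \<notin> (\<Union>G\<in>S. edges G)"
      unfolding Su(1,2) hole_graph_def by auto
    then show "e \<in> (\<Union>G\<in>R. edges G)" unfolding R_def by blast
  qed
  \<comment> \<open>Every edge inside \<open>X\<close> already belongs to a sun of \<open>S\<close>,
    which is also a sun of \<open>S'\<close>, so edge-disjointness forbids it to a new sun.\<close>
  have RX: "\<not> e \<subseteq> X" if "G \<in> R" "e \<in> edges G" for G e
  proof
    assume e: "e \<subseteq> X"
    have "card e = 2" using that Su(2) unfolding R_def by blast
    then obtain H where H: "H \<in> S" "e \<in> edges H" using e Su(1) by blast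
    then have "G \<noteq> H" "G \<in> S'" "H \<in> S'" using that S unfolding R_def by auto
    then have "edges G \<inter> edges H = {}" using Su(3) unfolding disjoint_family_on_def by auto
    then show False using that H by auto
  qed
  have Rsun: "is_sun (edges G)" if "G \<in> R" for G
    using that three_sun_system_is_sun[OF sys(2)] unfolding R_def by auto
  \<comment> \<open>At most one vertex of the triangle lies in \<open>X\<close>, and the opposite
    edge lies in the new part.\<close>
  have inU: "\<exists>e\<in>edges G. e \<subseteq> ?U" if G: "G \<in> R" for G
  proof -
    obtain a b c d e f where "edges G = sun_edges a b c d e f"
      using Rsun[OF G] unfolding is_sun_def by blast
    then have tri: "{a, b} \<in> edges G" "{b, c} \<in> edges G" "{c, a} \<in> edges G"
      unfolding sun_edges_def by auto
    have "edges G \<subseteq> (\<Union>G\<in>S'. edges G)" using G unfolding R_def by auto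
    then have "{a, b} \<subseteq> X'" "{b, c} \<subseteq> X'"
      using tri(1,2) unfolding Su(2) by (simp_all add: subset_eq)
    moreover have "\<not> (a \<in> X \<and> b \<in> X)" "\<not> (b \<in> X \<and> c \<in> X)" "\<not> (c \<in> X \<and> a \<in> X)"
      using tri[THEN RX[OF G]] by simp_all
    ultimately have "{a, b} \<subseteq> ?U \<or> {b, c} \<subseteq> ?U \<or> {c, a} \<subseteq> ?U" by simp argo
    then show ?thesis using tri by (elim disjE) (rule bexI; assumption)+
  qed
  then obtain p where p: "\<And>G. G \<in> R \<Longrightarrow> p G \<in> edges G \<and> p G \<subseteq> ?U" by metis
  have "inj_on p R"
  proof (rule inj_onI, rule ccontr)
    fix G H assume GH: "G \<in> R" "H \<in> R" "p G = p H" "G \<noteq> H"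
    then have "edges G \<inter> edges H = {}"
      using Su(3) unfolding disjoint_family_on_def R_def by auto
    then show False using p GH by (metis disjoint_iff)
  qed
  moreover have "p ` R \<subseteq> {e. e \<subseteq> ?U \<and> card e = 2}"
    using p Rsun is_sun_edge_card by fastforce
  moreover have "finite {e. e \<subseteq> ?U \<and> card e = 2}" using X by simp
  ultimately have fin: "finite R" and cR: "card R \<le> (m - n) choose 2"
    using n_subsets[of ?U 2] X U inj_on_finite[of p R] card_inj_on_le[of p R "{e. e \<subseteq> ?U \<and> card
        e = 2}"]
    by auto
  have "card (hole_graph X' X) \<le> card (\<Union>G\<in>R. edges G)"
    using un fin Rsun is_sun_finite by (intro card_mono) auto
  also have "\<dots> \<le> (\<Sum>G\<in>R. card (edges G))" using fin by (rule card_UN_le)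
  also have "\<dots> = 6 * card R" using sum.cong[OF refl is_sun_card[OF Rsun], of R] by simp
  finally have le: "m choose 2 \<le> 6 * ((m - n) choose 2) + (n choose 2)"
    using card_hole_graph[OF X(4,1)] X cR by simp
  define u where "u = m - n"
  have m: "m = n + u" "u > 0" using lt unfolding u_def by auto
  have "2 * real (m choose 2) = real m * (real m - 1)" for m :: nat
    by (induction m) (auto simp: numeral_2_eq_2 algebra_simps)
  note ch = this
  have "2 * real (m choose 2) \<le> 6 * (2 * real (u choose 2)) + 2 * real (n choose 2)"
    using of_nat_mono[OF le, where ?'a = real] unfolding u_def by simp
  \<comment> \<open>After cancelling \<open>n (n - 1)\<close>, the inequality between doubled edge
    counts reads \<open>2 n u + u (u - 1) \<le> 6 u (u - 1)\<close>, and a factor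
    \<open>u > 0\<close> can be removed.\<close>
  then have "real u * (2 * real n) \<le> real u * (5 * (real u - 1))"
    unfolding ch m(1) by (simp add: algebra_simps)
  then have "2 * real n \<le> 5 * (real u - 1)" using m(2) by simp
  then have "real (2 * n + 5) \<le> real (5 * u)" by simp
  then show ?thesis using m unfolding of_nat_le_iff by simp
qed

section \<open>Circulant graphs joined to hole vertices\<close>

text \<open>The new vertices are the residues modulo \<open>u\<close>, the hole vertices are natural numbers;
  \<open>diff_edges u d\<close> is the circulant graph of difference \<open>d\<close>, and \<open>hole_edges u t s\<close> joins all new
  vertices to the \<open>s\<close> hole vertices from \<open>t\<close> on.\<close>

definition pt :: "int \<Rightarrow> int \<Rightarrow> int + nat" where
  "pt u x = Inl (x mod u)"

definition diff_edges :: "int \<Rightarrow> int \<Rightarrow> (int + nat) set set" where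
  "diff_edges u d = {{pt u x, pt u (x + d)} | x. True}"

definition hole_edges :: "int \<Rightarrow> nat \<Rightarrow> nat \<Rightarrow> (int + nat) set set" where
  "hole_edges u t s = {{pt u x, Inr (t + i)} | x i. i < s}"

lemma pt_eq_iff: "pt u x = pt u y \<longleftrightarrow> u dvd x - y"
  unfolding pt_def by (simp add: mod_eq_dvd_iff)

lemma pt_neq_Inr [simp]: "pt u x \<noteq> Inr j" "Inr j \<noteq> pt u x"
  unfolding pt_def by auto

lemma pt_neq:
  assumes "0 < y - x" "y - x < u"
  shows "pt u x \<noteq> pt u y" "pt u y \<noteq> pt u x"
  using assms zdvd_not_zless[of "y - x" u] by (simp_all add: pt_eq_iff dvd_diff_commute)

lemma pt_add_mod [simp]: "pt u (x mod u + a) = pt u (x + a)" "pt u (x mod u) = pt u x"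
  unfolding pt_def by (simp_all add: mod_add_left_eq)

lemma hole_edges_Un: "hole_edges u t (s + s') = hole_edges u t s \<union> hole_edges u (t + s) s'"
proof (intro equalityI subsetI)
  fix e assume "e \<in> hole_edges u t (s + s')"
  then obtain x i where e: "e = {pt u x, Inr (t + i)}" "i < s + s'" unfolding hole_edges_def by auto
  show "e \<in> hole_edges u t s \<union> hole_edges u (t + s) s'"
  proof (cases "i < s")
    case True
    then show ?thesis using e unfolding hole_edges_def by auto
  next
    case False
    then have "e = {pt u x, Inr (t + s + (i - s))}" "i - s < s'" using e by auto
    then show ?thesis unfolding hole_edges_def by blast
  qed
next
  fix e assume "e \<in> hole_edges u t s \<union> hole_edges u (t + s) s'"
  then show "e \<in> hole_edges u t (s + s')"
  proof
    assume "e \<in> hole_edges u t s"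
    then show ?thesis unfolding hole_edges_def by fastforce
  next
    assume "e \<in> hole_edges u (t + s) s'"
    then obtain x i where "e = {pt u x, Inr (t + (s + i))}" "s + i < s + s'"
      unfolding hole_edges_def by (auto simp: add.assoc)
    then show ?thesis unfolding hole_edges_def by blast
  qed
qed

lemma hole_edges_0 [simp]: "hole_edges u t 0 = {}"
  unfolding hole_edges_def by simp

text \<open>Indexing the suns by all integers with period \<open>w\<close> lets an edge be located
  without normalising residues. The period may be a proper divisor of the number of residues, which
  yields configurations of fewer suns.\<close>

lemma sun_cover_cyclic:
  assumes "w > 0" "\<And>x. is_sun (B x)" "\<And>x. B (x mod w) = B x" "\<And>e. e \<in> E \<Longrightarrow> \<exists>x. e \<in> B x"
  shows "sun_cover E (nat w)"
proof (rule sun_cover_family[of "{0..<w}" _ B])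
  show "E \<subseteq> (\<Union>i\<in>{0..<w}. B i)"
  proof
    fix e assume "e \<in> E"
    then obtain x where "e \<in> B (x mod w)" using assms(3,4) by metis
    then show "e \<in> (\<Union>i\<in>{0..<w}. B i)" using assms(1) by (intro UN_I[of "x mod w"]) auto
  qed
qed (use assms in auto)

text \<open>The four colours 0, 1, 2, 3 add up to 6, so \<open>6 - (a + b + c)\<close> is the one
  missing from three distinct colours.\<close>

lemma fourth_colour:
  fixes a b c :: nat
  assumes "a < 4" "b < 4" "c < 4" "a \<noteq> b" "a \<noteq> c" "b \<noteq> c"
  shows "6 - (a + b + c) < 4" "6 - (a + b + c) \<noteq> a"
    "i < 4 \<Longrightarrow> i = a \<or> i = b \<or> i = c \<or> i = 6 - (a + b + c)"
proof -
  have cases: "a = 0 \<or> a = 1 \<or> a = 2 \<or> a = 3" "b = 0 \<or> b = 1 \<or> b = 2 \<or> b = 3"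
    "c = 0 \<or> c = 1 \<or> c = 2 \<or> c = 3" using assms(1-3) by auto
  show "6 - (a + b + c) < 4" "6 - (a + b + c) \<noteq> a"
    using cases assms(4-6) by (elim disjE; simp)+
  assume i: "i < 4"
  show "i = a \<or> i = b \<or> i = c \<or> i = 6 - (a + b + c)"
  proof (rule ccontr)
    assume "\<not> ?thesis"
    then have neq: "i \<noteq> a" "i \<noteq> b" "i \<noteq> c" "i \<noteq> 6 - (a + b + c)" by auto
    have "{a, b, c, i} = {..<4}"
      using assms i neq by (intro card_subset_eq) auto
    then have "\<Sum>{a, b, c, i} = \<Sum>{..<4}" by simp
    then have "a + (b + (c + i)) = 6" using assms neq by (simp add: numeral_eq_Suc)
    then show False using neq(4) by simp
  qed
qed

text \<open>The vertex \<open>x\<close> lies in the triangles of the hole vertices coloured \<open>c x\<close> and \<open>c (x - d)\<close>, is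
  the pendant vertex of the hole vertex coloured \<open>c (x - 2 * d)\<close>, and sends its own two pendant edges to
  the hole vertex of the remaining colour and to \<open>g x\<close>.\<close>

lemma sun_cover_colouring:
  assumes u: "u > 0" and d: "\<not> u dvd d" "\<not> u dvd 2 * d"
    and c: "\<And>x. c (x mod u) = c x" "\<And>x. c x < (4 :: nat)"
      "\<And>x. c x \<noteq> c (x + d)" "\<And>x. c x \<noteq> c (x + 2 * d)"
    and g: "\<And>x. g (x mod u) = g x" "\<And>x i. i < 4 \<Longrightarrow> g x \<noteq> Inr (t + i)"
      "\<And>x. g x \<noteq> pt u x" "\<And>x. g x \<noteq> pt u (x - d)" "\<And>x. g x \<noteq> pt u (x + d)"
  shows "sun_cover (diff_edges u d \<union> hole_edges u t 4 \<union> {{pt u x, g x} | x. True}) (nat u)"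
proof -
  define p where "p x = 6 - (c x + c (x - d) + c (x - 2 * d))" for x
  define B where "B x = sun_edges (Inr (t + c x)) (pt u x) (pt u (x + d))
    (pt u (x + 2 * d)) (Inr (t + p x)) (g (x + d))" for x
  have cm: "c (x mod u + a) = c (x + a)" for x a
    by (metis c(1) mod_add_left_eq)
  have gm: "g (x mod u + a) = g (x + a)" for x a
    by (metis g(1) mod_add_left_eq)
  have cc: "c x \<noteq> c (x - d)" "c x \<noteq> c (x - 2 * d)" "c (x - d) \<noteq> c (x - 2 * d)" for x
    using c(3)[of "x - d"] c(4)[of "x - 2 * d"] c(3)[of "x - 2 * d"] by (simp_all add:
        algebra_simps)
  note fc = fourth_colour[OF c(2) c(2) c(2) cc(1) cc(2) cc(3), folded p_def]
  show ?thesis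
  proof (rule sun_cover_cyclic[of _ B])
    fix x
    have "pt u x \<noteq> pt u (x + d)" "pt u x \<noteq> pt u (x + 2 * d)" "pt u (x + d) \<noteq> pt u (x + 2 * d)"
      using d by (simp_all add: pt_eq_iff)
    moreover have "g (x + d) \<noteq> pt u x" "g (x + d) \<noteq> pt u (x + 2 * d)"
      using g(4)[of "x + d"] g(5)[of "x + d"] by (simp_all add: algebra_simps)
    ultimately show "is_sun (B x)"
      unfolding B_def using fc(1,2)[of x] g(2)[OF c(2)] g(2)[OF fc(1)] g(3)[of "x + d"]
      by (intro is_sunI) (auto simp: eq_commute[of _ "g (x + d)"])
    have "c (x mod u - a) = c (x - a)" for a using cm[of x "- a"] by simp
    then show "B (x mod u) = B x"
      unfolding B_def p_def by (simp add: cm gm c(1))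
  next
    fix e assume "e \<in> diff_edges u d \<union> hole_edges u t 4 \<union> {{pt u x, g x} | x. True}"
    then consider x where "e = {pt u x, pt u (x + d)}" | x i where "e = {pt u x, Inr (t + i)}"
        "i < 4"
      | x where "e = {pt u x, g x}" unfolding diff_edges_def hole_edges_def by auto
    then show "\<exists>x. e \<in> B x"
    proof cases
      case 1
      then show ?thesis unfolding B_def sun_edges_def by auto
    next
      case 2
      from fc(3)[OF 2(2), of x] consider "i = c x" | "i = c (x - d)" | "i = c (x - 2 * d)" | "i
          = p x"
        by auto
      then show ?thesis
      proof cases
        case 1
        then have "e \<in> B x" using 2 unfolding B_def sun_edges_def by auto
        then show ?thesis ..
      next
        case a: 2
        then have "e \<in> B (x - d)" using 2 unfolding B_def sun_edges_def by auto
        then show ?thesis ..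
      next
        case 3
        then have "e \<in> B (x - 2 * d)" using 2 unfolding B_def sun_edges_def by auto
        then show ?thesis ..
      next
        case 4
        then have "e \<in> B x" using 2 unfolding B_def sun_edges_def by auto
        then show ?thesis ..
      qed
    next
      case (3 x)
      then have "e \<in> B (x - d)" unfolding B_def sun_edges_def by auto
      then show ?thesis ..
    qed
  qed fact
qed

text \<open>Along a cycle of length \<open>k\<close> the colour word is \<open>(012)\<^sup>a(0123)\<^sup>b\<close> with \<open>b = k mod 3\<close>;
  only \<open>k = 5\<close> is too short for its remainder.\<close>

lemma cycle_colouring:
  fixes k :: int
  assumes "k \<ge> 3" "k \<noteq> 5"
  obtains f :: "int \<Rightarrow> nat" where "\<And>j. f j < 4"
    "\<And>j. 0 \<le> j \<Longrightarrow> j < k \<Longrightarrow> f j \<noteq> f ((j + 1) mod k)"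
    "\<And>j. 0 \<le> j \<Longrightarrow> j < k \<Longrightarrow> f j \<noteq> f ((j + 2) mod k)"
proof
  define m b where "m = k - 4 * (k mod 3)" and "b = k mod 3"
  have k: "k = m + 4 * b" "b \<ge> 0" by (simp_all add: m_def b_def)
  have m: "m mod 3 = 0" "m \<ge> 0" unfolding m_def using assms by presburger+
  then obtain a where a: "m = 3 * a" "a \<ge> 0" by (metis mod_0_imp_dvd dvd_def zero_le_mult_iff
      not_numeral_le_zero)
  define f where "f j = (if j < m then j mod 3 else (j - m) mod 4)" for j
  have f01: "f 0 = 0" "f 1 = 1" using a k assms by (auto simp: f_def)
  have top: "f (m - 1) = 2" "f (m - 2) = 1" if "m > 0"
  proof -
    have "(3 * a - 1) mod 3 = 2" "(3 * a - 2) mod 3 = 1" by presburger+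
    then show "f (m - 1) = 2" "f (m - 2) = 1" using that by (simp_all add: f_def a)
  qed
  have mid: "f m = 0" "f (1 + m) = 1" if "b > 0" using that by (simp_all add: f_def)
  have last: "f (k - 1) = 3" "f (k - 2) = 2" if "b > 0"
  proof -
    have "(4 * b - 1) mod 4 = 3" "(4 * b - 2) mod 4 = 2" by presburger+
    then show "f (k - 1) = 3" "f (k - 2) = 2" using that by (simp_all add: f_def k)
  qed
  \<comment> \<open>Both kinds of blocks start with 01 and end in 12 or in 23, so equal letters
    never come within distance 2 across a boundary. The passage from position \<open>k - 1\<close>
    to 0 is one more such boundary.\<close>
  have ne: "f j \<noteq> (if j + s < k then f (j + s) else f (j + s - k))"
    if j: "0 \<le> j" "j < k" and s: "s = 1 \<or> s = 2" for j s
  proof -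
    consider "j + s < m" | "j < m" "m \<le> j + s" | "m \<le> j" "j + s < k" | "m \<le> j" "k \<le> j + s"
      by linarith
    then show ?thesis
    proof cases
      case 1
      have "j mod 3 \<noteq> (j + s) mod 3" using s by (elim disjE; simp; presburger)
      then show ?thesis using 1 s k by (auto simp: f_def)
    next
      case 2
      then have "j = m - 1 \<or> j = m - 2 \<and> s = 2" "m > 0" using s j by auto
      then show ?thesis
        using s k f01 top mid by (cases "b > 0") auto
    next
      case 3
      have "z mod 4 \<noteq> (z + s) mod 4" for z using s by (elim disjE; simp; presburger)
      then have "(j - m) mod 4 \<noteq> (j - m + s) mod 4" .
      then show ?thesis using 3 s by (auto simp: f_def algebra_simps)
    next
      case 4
      then have "j = k - 1 \<or> j = k - 2 \<and> s = 2" "b > 0" using s j k by auto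
      then show ?thesis using s f01 last by auto
    qed
  qed
  have f_range: "0 \<le> f j" "f j < 4" for j
  proof -
    have "0 \<le> j mod 3 \<and> j mod 3 < 4" "0 \<le> (j - m) mod 4 \<and> (j - m) mod 4 < 4" by presburger+
    then show "0 \<le> f j" "f j < 4" by (simp_all add: f_def)
  qed
  then have n: "nat (f i) \<noteq> nat (f j) \<longleftrightarrow> f i \<noteq> f j" for i j by (metis int_nat_eq)
  have sh: "(j + s) mod k = (if j + s < k then j + s else j + s - k)"
    if "0 \<le> j" "j < k" "s = 1 \<or> s = 2" for j s
  proof (cases "j + s < k")
    case False
    have "(j + s) mod k = (j + s - k) mod k" by (rule minus_mod_self2[symmetric])
    also have "\<dots> = j + s - k" using False that assms by (intro mod_pos_pos_trivial) auto
    finally show ?thesis using False by simp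
  qed (use that in auto)
  show "nat (f j) < 4" for j using f_range[of j] by simp
  fix j assume j: "0 \<le> j" "j < k"
  show "nat (f j) \<noteq> nat (f ((j + 1) mod k))"
    unfolding n using ne[OF j, of 1] sh[OF j, of 1] by (simp split: if_splits)
  show "nat (f j) \<noteq> nat (f ((j + 2) mod k))"
    unfolding n using ne[OF j, of 2] sh[OF j, of 2] by (simp split: if_splits)
qed

text \<open>Steps of length \<open>d\<close> split the residues into \<open>gcd d u\<close> cycles
  of the common length \<open>k\<close>, the order of \<open>d\<close> modulo \<open>u\<close>. A
  colouring of one cycle is copied to all of them; the hypotheses exclude exactly
  \<open>k = 1\<close>, \<open>k = 2\<close> and \<open>k = 5\<close>.\<close>

lemma circulant_colouring:
  fixes u d :: int
  assumes u: "u > 0" and d: "\<not> u dvd d" "\<not> u dvd 2 * d" "\<not> u dvd 5 * d"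
  obtains c :: "int \<Rightarrow> nat" where "\<And>x. c (x mod u) = c x" "\<And>x. c x < 4"
      "\<And>x. c x \<noteq> c (x + d)" "\<And>x. c x \<noteq> c (x + 2 * d)"
proof -
  define g where "g = gcd d u"
  define k where "k = u div g"
  define d' where "d' = d div g"
  have g: "g > 0" using u by (simp add: g_def)
  have ud: "u = g * k" "d = g * d'" by (simp_all add: k_def d'_def g_def)
  have "k > 0" using u g ud(1) by (simp add: zero_less_mult_iff)
  have dv: "u dvd a * d \<longleftrightarrow> k dvd a * d'" for a
    using g unfolding ud by (metis dvd_mult_cancel_left less_irrefl mult.left_commute)
  have "k \<noteq> 1" "k \<noteq> 2" "k \<noteq> 5" using d dv[of 1] dv[of 2] dv[of 5] by auto
  then have k: "k \<ge> 3" "k \<noteq> 5" using \<open>k > 0\<close> by auto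
  obtain p q where "p * d + q * u = g" unfolding g_def using bezout_int by blast
  then have "g * (p * d' + q * k) = g * 1" unfolding ud(1) ud(2) by (simp add: algebra_simps)
  then have "p * d' + q * k = 1" using g unfolding mult_cancel_left by simp
  then have e: "d' * p = 1 - k * q" by (simp add: algebra_simps)
  \<comment> \<open>The position of \<open>x\<close> on its cycle: \<open>x div g\<close> numbers
    the elements of a class modulo \<open>g\<close>, and \<open>p\<close> is inverse to
    \<open>d'\<close> modulo \<open>k\<close>, so a step by \<open>d\<close> raises the position by
    1.\<close>
  define j where "j x = ((x div g) * p) mod k" for x
  have jd: "j (x + a * d) = (j x + a) mod k" for x a
  proof -
    have "(x + a * d) div g = x div g + a * d'" 
      using g div_mult_self2[of g x "a * d'"] by (simp add: ud(2) mult.left_commute)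
    then have "j (x + a * d) = ((x div g) * p + a * (d' * p)) mod k"
      by (simp add: j_def algebra_simps)
    also have "\<dots> = ((x div g) * p + a + k * (- (a * q))) mod k"
      unfolding e by (simp add: algebra_simps)
    also have "\<dots> = ((x div g) * p + a) mod k" by (rule mod_mult_self2)
    finally show ?thesis by (simp add: j_def mod_add_left_eq)
  qed
  have ju: "j (x + a * u) = j x" for x a
  proof -
    have "(x + a * u) div g = x div g + a * k" 
      using g div_mult_self2[of g x "a * k"] by (simp add: ud(1) mult.left_commute)
    then have "j (x + a * u) = ((x div g) * p + k * (a * p)) mod k"
      by (simp add: j_def algebra_simps)
    then show ?thesis by (simp add: j_def)
  qed
  obtain f :: "int \<Rightarrow> nat" where f: "\<And>j. f j < 4"
    "\<And>j. 0 \<le> j \<Longrightarrow> j < k \<Longrightarrow> f j \<noteq> f ((j + 1) mod k)"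
    "\<And>j. 0 \<le> j \<Longrightarrow> j < k \<Longrightarrow> f j \<noteq> f ((j + 2) mod k)"
    using cycle_colouring[OF k] by metis
  have jr: "0 \<le> j x" "j x < k" for x using \<open>k > 0\<close> by (simp_all add: j_def)
  show thesis
  proof (rule that[of "\<lambda>x. f (j x)"])
    fix x
    have "x mod u = x + (- (x div u)) * u" by (simp add: minus_div_mult_eq_mod [symmetric])
    then show "f (j (x mod u)) = f (j x)" using ju by metis
    show "f (j x) \<noteq> f (j (x + d))" using f(2)[OF jr] jd[of x 1] by simp
    show "f (j x) \<noteq> f (j (x + 2 * d))" using f(3)[OF jr] jd[of x 2] by simp
  qed (use f in auto)
qed

section \<open>Blocks of \<open>u\<close> suns\<close>

lemma pt_eq_close: "\<bar>x - y\<bar> < u \<Longrightarrow> pt u x = pt u y \<longleftrightarrow> x = y"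
  using pt_neq[of y x u] pt_neq[of x y u] by (cases x y rule: linorder_cases) auto

lemma pt_mult_mod [simp]:
  "pt (k * w) (k * (x mod w) + a) = pt (k * w) (k * x + a)"
  "pt (k * w) (k * (x mod w)) = pt (k * w) (k * x)"
  unfolding pt_def by (metis mult_mod_right mod_add_left_eq, metis mult_mod_right mod_mod_trivial)

lemma dvd_small_multiple:
  fixes a u :: int
  assumes "u dvd a" "0 < a" "a < 3 * u"
  shows "a = u \<or> a = 2 * u"
proof -
  obtain q where q: "a = u * q" using assms(1) by (elim dvdE)
  have "u > 0" using assms(2,3) by simp
  have "u * 0 < u * q" "u * q < u * 3" using assms(2,3) unfolding q by linarith+
  then have "0 < q" "q < 3" using \<open>u > 0\<close> by (simp_all only: mult_less_cancel_left_pos)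
  then have "q = 1 \<or> q = 2" by auto
  then show ?thesis using q by auto
qed

text \<open>The free pendant edge \<open>g x\<close> of the colouring construction carries the
  second difference. Only \<open>d\<close> has to be coloured, so \<open>d'\<close> may have order
  5.\<close>

lemma sun_cover_two_differences:
  assumes d: "0 < d" "2 * d < u" "\<not> u dvd 5 * d" and d': "0 < d'" "2 * d' < u" "d \<noteq> d'"
  shows "sun_cover (diff_edges u d \<union> diff_edges u d' \<union> hole_edges u t 4) (nat u)"
proof -
  have u: "u > 0" using d by simp
  have nd: "\<not> u dvd d" "\<not> u dvd 2 * d" using d zdvd_not_zless[of d u] zdvd_not_zless[of "2 * d"
      u] by auto
  obtain c :: "int \<Rightarrow> nat" where c: "\<And>x. c (x mod u) = c x" "\<And>x. c x < 4"
      "\<And>x. c x \<noteq> c (x + d)" "\<And>x. c x \<noteq> c (x + 2 * d)"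
    using circulant_colouring[OF u nd d(3)] by metis
  have "sun_cover (diff_edges u d \<union> hole_edges u t 4 \<union> {{pt u x, pt u (x + d')} | x. True}) (nat u)"
    using d d' nd by (intro sun_cover_colouring[where c = c] c) (auto simp: pt_eq_close)
  then show ?thesis by (rule sun_cover_mono) (auto simp: diff_edges_def)
qed

text \<open>In general the free pendant edges all go to a fifth hole vertex. A difference of order 5
  has no suitable colouring with four colours, but then all five hole vertices can serve as colours
  along the 5-cycles.\<close>

lemma sun_cover_one_difference:
  assumes d: "0 < d" "2 * d < u"
  shows "sun_cover (diff_edges u d \<union> hole_edges u t 5) (nat u)"
proof (cases "u dvd 5 * d")
  case False
  have u: "u > 0" using d by simp
  have nd: "\<not> u dvd d" "\<not> u dvd 2 * d" using d zdvd_not_zless[of d u] zdvd_not_zless[of "2 * d"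
      u] by auto
  obtain c :: "int \<Rightarrow> nat" where c: "\<And>x. c (x mod u) = c x" "\<And>x. c x < 4"
      "\<And>x. c x \<noteq> c (x + d)" "\<And>x. c x \<noteq> c (x + 2 * d)"
    using circulant_colouring[OF u nd False] by metis
  have "sun_cover (diff_edges u d \<union> hole_edges u t 4 \<union> {{pt u x, Inr (t + 4)} | x. True}) (nat u)"
    using d nd by (intro sun_cover_colouring[where c = c] c) auto
  moreover have "hole_edges u t 5 = hole_edges u t 4 \<union> hole_edges u (t + 4) 1" using
      hole_edges_Un[of u t 4 1] by simp
  ultimately show ?thesis by (elim sun_cover_mono) (auto simp: hole_edges_def)
next
  case True
  have u: "u > 0" using d by simp
  have "5 * d = u \<or> 5 * d = 2 * u" using True d by (intro dvd_small_multiple) auto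
  then obtain q where q: "5 * d = u * q" and q12: "q = 1 \<or> q = 2" by fastforce
  define w where "w = u div 5"
  have w: "u = 5 * w" "d = q * w" "w > 0" using q12 q u unfolding w_def by auto presburger+
  define H where "H i = (Inr (t + nat (i mod 5)) :: int + nat)" for i :: int
  have H_eq: "H i = H j \<longleftrightarrow> i mod 5 = j mod 5" for i j
    unfolding H_def by (auto simp: nat_eq_iff)
  define C where "C x = x div w" for x
  have C: "C (x + a * d) = C x + a * q" for x a
    using div_mult_self2[of w x "a * q"] w(3) unfolding C_def w(2) by (simp add: algebra_simps)
  have Cu: "C (x + a * u) = C x + 5 * a" for x a
    using div_mult_self2[of w x "5 * a"] w(3) unfolding C_def w(1) by (simp add: algebra_simps)
  \<comment> \<open>A vertex \<open>x\<close> occurs in the roles of \<open>B x\<close>,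
    \<open>B (x - d)\<close> and \<open>B (x - 2 * d)\<close>. Together they join it to the hole
    vertices with offsets \<open>0\<close>, \<open>q\<close>, \<open>-q\<close>,
    \<open>2 * q\<close> and \<open>-2 * q\<close> from \<open>C x\<close>, which are all residues
    modulo 5.\<close>
  define B where "B x = sun_edges (H (C x)) (pt u x) (pt u (x + d)) (pt u (x + 2 * d))
    (H (C x + q)) (H (C x + 3 * q))" for x
  show ?thesis
  proof (rule sun_cover_cyclic[of _ B])
    fix x
    have "pt u x \<noteq> pt u (x + d)" "pt u x \<noteq> pt u (x + 2 * d)" "pt u (x + d) \<noteq> pt u (x + 2 * d)"
      using d by (simp_all add: pt_eq_close)
    moreover have "H i \<noteq> pt u y" for i y unfolding H_def by simp
    moreover have "C x mod 5 \<noteq> (C x + q) mod 5" "C x mod 5 \<noteq> (C x + 3 * q) mod 5"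
      "(C x + q) mod 5 \<noteq> (C x + 3 * q) mod 5" using q12 by (elim disjE; simp; presburger)+
    ultimately show "is_sun (B x)"
      unfolding B_def by (intro is_sunI) (auto simp: H_eq eq_commute[of "pt u _" "H _"])
    have "x mod u = x + (- (x div u)) * u" by (simp add: minus_div_mult_eq_mod [symmetric])
    then obtain z where "C (x mod u) = C x + 5 * z" using Cu by metis
    then have "H (C (x mod u) + a) = H (C x + a)" for a unfolding H_eq
      using mod_mult_self2[of "C x + a" 5 z] by (simp add: algebra_simps)
    from this this[of 0] show "B (x mod u) = B x" unfolding B_def by simp
  next
    fix e assume "e \<in> diff_edges u d \<union> hole_edges u t 5"
    then consider x where "e = {pt u x, pt u (x + d)}" | x i where "e = {pt u x, Inr (t + i)}"
        "i < 5"
      unfolding diff_edges_def hole_edges_def by auto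
    then show "\<exists>x. e \<in> B x"
    proof cases
      case 1
      then show ?thesis unfolding B_def sun_edges_def by auto
    next
      case (2 x i)
      have e: "e = {pt u x, H j}" if "j mod 5 = int i" for j using 2 that unfolding H_def by simp
      have C1: "C (x - d) = C x - q" "C (x - 2 * d) = C x - 2 * q"
        using C[of x "-1"] C[of x "-2"] by simp_all
      have "C x mod 5 = int i \<or> (C x - q) mod 5 = int i \<or> (C x - 2 * q) mod 5 = int i
        \<or> (C x + q) mod 5 = int i \<or> (C x + 2 * q) mod 5 = int i"
      proof -
        define r where "r = (int i - C x) mod 5"
        have r: "(C x + r) mod 5 = int i"
          using 2(2) by (simp add: r_def mod_add_right_eq)
        have "0 \<le> r" "r < 5" by (simp_all add: r_def)
        then have r5: "r = 0 \<or> r = 1 \<or> r = 2 \<or> r = 3 \<or> r = 4" by linarith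
        have shift: "(C x + 3) mod 5 = (C x - 2) mod 5" "(C x + 4) mod 5 = (C x - 1) mod 5"
          "(C x + 1) mod 5 = (C x - 4) mod 5"
          using mod_add_self2[of "C x - 2" 5] mod_add_self2[of "C x - 1" 5] mod_add_self2[of "C
              x - 4" 5]
          by (simp_all add: add.commute)
        have all: "C x mod 5 = int i \<or> (C x + 1) mod 5 = int i \<or> (C x + 2) mod 5 = int i
          \<or> (C x + 3) mod 5 = int i \<or> (C x + 4) mod 5 = int i"
          using r5
        proof (elim disjE)
          assume "r = 0"
          then show ?thesis using r by simp
        qed (use r in blast)+
        show ?thesis using q12
        proof
          assume "q = 1"
          then show ?thesis using all unfolding shift(1,2) by (simp only: mult_1_right) blast
        next
          assume "q = 2"
          moreover have "2 * 2 = (4 :: int)" by simp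
          ultimately show ?thesis using all unfolding shift(1,3) by (simp only:) blast
        qed
      qed
      then show ?thesis
      proof (elim disjE)
        assume "C x mod 5 = int i"
        from e[OF this] have "e \<in> B x" unfolding B_def sun_edges_def by auto
        then show ?thesis ..
      next
        assume "(C x - q) mod 5 = int i"
        from e[OF this] have "e \<in> B (x - d)" unfolding B_def sun_edges_def C1 by auto
        then show ?thesis ..
      next
        assume "(C x - 2 * q) mod 5 = int i"
        from e[OF this] have "e \<in> B (x - 2 * d)" unfolding B_def sun_edges_def C1 by auto
        then show ?thesis ..
      next
        assume "(C x + q) mod 5 = int i"
        from e[OF this] have "e \<in> B x" unfolding B_def sun_edges_def by auto
        then show ?thesis ..
      next
        assume "(C x + 2 * q) mod 5 = int i"
        moreover have "C x + 2 * q = C (x - d) + 3 * q" unfolding C1 by simp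
        ultimately have "e = {pt u (x - d + d), H (C (x - d) + 3 * q)}"
          using e[of "C x + 2 * q"] by (metis diff_add_cancel)
        then have "e \<in> B (x - d)" unfolding B_def sun_edges_def by simp
        then show ?thesis ..
      qed
    qed
  qed fact
qed

text \<open>The translates of one sun: its triangle lies among the new vertices and has one edge of
  each difference \<open>a\<close>, \<open>b\<close>, \<open>a + b\<close>, and its pendant edges
  supply two hole vertices and difference \<open>c\<close>. This block uses the fewest hole vertices
  per difference.\<close>

lemma sun_cover_difference_triple:
  assumes "0 < a" "0 < b" "2 * (a + b) < u" "0 < c" "2 * c < u"
  shows "sun_cover (diff_edges u a \<union> diff_edges u b \<union> diff_edges u (a + b) \<union> diff_edges u c \<union>
      hole_edges u t 2) (nat u)"
proof (rule sun_cover_cyclic)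
  let ?B = "\<lambda>x. sun_edges (pt u x) (pt u (x + a)) (pt u (x + (a + b))) (Inr t) (Inr (t + 1))
    (pt u (x + (a + b + c)))"
  fix x
  show "is_sun (?B x)"
    using assms by (intro is_sunI) (simp add: pt_eq_close)
  show "?B (x mod u) = ?B x" by simp
next
  let ?B = "\<lambda>x. sun_edges (pt u x) (pt u (x + a)) (pt u (x + (a + b))) (Inr t) (Inr (t + 1))
    (pt u (x + (a + b + c)))"
  fix e assume "e \<in> diff_edges u a \<union> diff_edges u b \<union> diff_edges u (a + b) \<union> diff_edges u c \<union>
      hole_edges u t 2"
  then consider x where "e = {pt u x, pt u (x + a)}" | x where "e = {pt u x, pt u (x + b)}"
    | x where "e = {pt u x, pt u (x + (a + b))}" | x where "e = {pt u x, pt u (x + c)}"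
    | x where "e = {pt u x, Inr t}" | x where "e = {pt u x, Inr (t + 1)}"
    unfolding diff_edges_def hole_edges_def by (auto simp: less_2_cases_iff)
  then show "\<exists>x. e \<in> ?B x"
  proof cases
    case (2 x)
    then have "e \<in> ?B (x - a)" by (simp add: sun_edges_def)
    then show ?thesis by blast
  next
    case (4 x)
    then have "e \<in> ?B (x - (a + b))" by (simp add: sun_edges_def)
    then show ?thesis by blast
  next
    case (6 x)
    then have "e \<in> ?B (x - a)" by (simp add: sun_edges_def)
    then show ?thesis by blast
  qed (auto simp: sun_edges_def)
qed (use assms in simp)

text \<open>There are \<open>2 * u = 6 * w\<close> edges, so each block of three consecutive
  residues gets one sun. The hole vertex takes \<open>3 * i + 5\<close> from the next block as
  pendant vertex, since \<open>3 * i + 2\<close> is already the pendant vertex of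
  \<open>3 * i + 1\<close>; \<open>w \<ge> 3\<close> keeps it apart from
  \<open>3 * i - 1\<close>.\<close>

lemma sun_cover_one_hole_vertex:
  assumes u: "u = 3 * w" "w \<ge> 3"
  shows "sun_cover (diff_edges u 1 \<union> hole_edges u t 1) (nat w)"
proof -
  define B where "B i = sun_edges (Inr t) (pt u (3 * i)) (pt u (3 * i + 1)) (pt u (3 * i + 5))
    (pt u (3 * i - 1)) (pt u (3 * i + 2))" for i
  have "pt u (3 * (i mod w) - 1) = pt u (3 * i - 1)" for i
    using pt_mult_mod(1)[of 3 w i "-1"] u by simp
  then have per: "B (i mod w) = B i" for i unfolding B_def u(1) by (simp add: u(1)[symmetric])
      (simp add: u(1))
  show ?thesis
  proof (rule sun_cover_cyclic[of _ B])
    show "is_sun (B i)" for i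
      unfolding B_def using u by (intro is_sunI) (simp add: pt_eq_close)
    fix e assume "e \<in> diff_edges u 1 \<union> hole_edges u t 1"
    then obtain x where x: "e = {pt u x, pt u (x + 1)} \<or> e = {pt u x, Inr t}"
      unfolding diff_edges_def hole_edges_def by auto
    have "\<exists>i. x = 3 * i \<or> x = 3 * i + 1 \<or> x = 3 * i + 2" by presburger
    then obtain i where "x = 3 * i \<or> x = 3 * i + 1 \<or> x = 3 * i + 2" ..
    then show "\<exists>i. e \<in> B i"
    proof (elim disjE)
      assume "x = 3 * i"
      then have "e \<in> B i" using x by (elim disjE) (simp_all add: B_def sun_edges_def
          insert_commute algebra_simps)
      then show ?thesis ..
    next
      assume "x = 3 * i + 1"
      then have "e \<in> B i" using x by (elim disjE) (simp_all add: B_def sun_edges_def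
          insert_commute algebra_simps)
      then show ?thesis ..
    next
      assume x2: "x = 3 * i + 2"
      from x show ?thesis
      proof
        assume "e = {pt u x, pt u (x + 1)}"
        then have "e \<in> B (i + 1)" using x2 by (simp add: B_def sun_edges_def insert_commute
            algebra_simps)
        then show ?thesis ..
      next
        assume "e = {pt u x, Inr t}"
        then have "e \<in> B (i - 1)" using x2 by (simp add: B_def sun_edges_def insert_commute
            algebra_simps)
        then show ?thesis ..
      qed
    qed
  qed (use per u in auto)
qed

text \<open>Since \<open>d\<close> is odd, the paths \<open>4 * i\<close>, \<open>4 * i + d\<close>,
  \<open>4 * i + 2 * d\<close>, \<open>4 * i + 3 * d\<close> partition the residues. Each path
  carries two suns, one for each hole vertex, whose triangles use its first and its third
  edge.\<close>

lemma sun_cover_two_hole_vertices: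
  assumes u: "u = 4 * w" "w \<ge> 2" and d: "odd d" "0 < d" "2 * d < u"
  shows "sun_cover (diff_edges u d \<union> hole_edges u t 2) (nat w + nat w)"
proof -
  define B where "B i = sun_edges (Inr t) (pt u (4 * i)) (pt u (4 * i + d)) (pt u (4 * i + 3 * d))
    (Inr (t + 1)) (pt u (4 * i + 2 * d))" for i
  define B' where "B' i = sun_edges (Inr (t + 1)) (pt u (4 * i + 2 * d)) (pt u (4 * i + 3 * d))
    (pt u (4 * i + d)) (Inr t) (pt u (4 * i + 4 * d))" for i
  have nd: "\<not> u dvd 3 * d"
  proof
    assume "u dvd 3 * d"
    then have "3 * d = u \<or> 3 * d = 2 * u" using d by (intro dvd_small_multiple) auto
    then have "3 * d = u" using d by auto
    then show False using d(1) u(1) by presburger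
  qed
  have nd': "\<not> u dvd d" "\<not> u dvd 2 * d" using d zdvd_not_zless[of d u] zdvd_not_zless[of "2 * d"
      u] by auto
  have "sun_cover (\<Union>i. B i) (nat w)"
  proof (rule sun_cover_cyclic[of _ B])
    show "is_sun (B i)" for i
      unfolding B_def using nd nd' by (intro is_sunI) (simp add: pt_eq_iff)
    show "B (i mod w) = B i" for i unfolding B_def u(1) by simp
  qed (use u in auto)
  moreover have "sun_cover (\<Union>i. B' i) (nat w)"
  proof (rule sun_cover_cyclic[of _ B'])
    show "is_sun (B' i)" for i
      unfolding B'_def using nd nd' by (intro is_sunI) (simp add: pt_eq_iff)
    show "B' (i mod w) = B' i" for i unfolding B'_def u(1) by simp
  qed (use u in auto)
  ultimately have "sun_cover ((\<Union>i. B i) \<union> (\<Union>i. B' i)) (nat w + nat w)" by (rule sun_cover_Un)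
  moreover have "diff_edges u d \<union> hole_edges u t 2 \<subseteq> (\<Union>i. B i) \<union> (\<Union>i. B' i)"
  proof
    fix e assume "e \<in> diff_edges u d \<union> hole_edges u t 2"
    then obtain x where x: "e = {pt u x, pt u (x + d)} \<or> e = {pt u x, Inr t} \<or> e = {pt u x, Inr
        (t + 1)}"
    proof -
      from \<open>e \<in> _\<close> consider x where "e = {pt u x, pt u (x + d)}" | x where "e = {pt u x, Inr t}"
        | x where "e = {pt u x, Inr (t + 1)}"
        unfolding diff_edges_def hole_edges_def by (auto simp: less_2_cases_iff)
      then show thesis using that by cases blast+
    qed
    have "\<exists>i. x = 4 * i \<or> x = 4 * i + d \<or> x = 4 * i + 2 * d \<or> x = 4 * i + 3 * d"
      using d(1) by presburger
    then obtain i where i: "x = 4 * i \<or> x = 4 * i + d \<or> x = 4 * i + 2 * d \<or> x = 4 * i + 3 * d" ..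
    then have "e \<in> B i \<union> B' i"
      using x by (elim disjE) (simp_all add: B_def B'_def sun_edges_def insert_commute
          algebra_simps)
    then show "e \<in> (\<Union>i. B i) \<union> (\<Union>i. B' i)" by blast
  qed
  ultimately show ?thesis by (rule sun_cover_mono) simp
qed

lemma residue_mod_4:
  fixes x r :: int
  assumes "0 \<le> r" "r < 4"
  shows "x mod 4 = r \<or> (x - 1) mod 4 = r \<or> (x - 2) mod 4 = r \<or> (x - 3) mod 4 = r"
proof -
  define s where "s = (x - r) mod 4"
  have "(x - s) mod 4 = r" using assms by (simp add: s_def mod_diff_right_eq)
  moreover have "0 \<le> s" "s < 4" by (simp_all add: s_def)
  then have "s = 0 \<or> s = 1 \<or> s = 2 \<or> s = 3" by linarith
  ultimately show ?thesis by (elim disjE) simp_all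
qed

text \<open>Even vertices below \<open>u / 2\<close> send their edge of difference \<open>u / 2\<close> out as a pendant edge, while
  the edges of difference \<open>u / 2\<close> between odd vertices lie in triangles with the last hole vertex.\<close>

lemma sun_cover_half_difference:
  assumes u: "u = 4 * w" "w \<ge> 2"
  shows "sun_cover (diff_edges u 1 \<union> diff_edges u (2 * w) \<union> hole_edges u t 6) (nat u + nat w)"
proof -
  define H where "H i = (Inr (t + nat (i mod 4)) :: int + nat)" for i :: int
  define F where "F x \<longleftrightarrow> x mod u < 2 * w" for x
  define e f where "e = (Inr (t + 4) :: int + nat)" and "f = (Inr (t + 5) :: int + nat)"
  have H_eq: "H i = H j \<longleftrightarrow> i mod 4 = j mod 4" for i j
    unfolding H_def by (auto simp: nat_eq_iff)
  have "nat (i mod 4) < 4" for i :: int by simp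
  then have H_neq: "H i \<noteq> e" "H i \<noteq> f" "H i \<noteq> pt v x" "e \<noteq> f" "e \<noteq> pt v x" "f \<noteq> pt v x" for i x v
    unfolding H_def e_def f_def by (auto simp: less_Suc_eq)
  note H_neq' = H_neq(1-3,5,6)[symmetric] H_neq(4)[symmetric]
  \<comment> \<open>This varies the colouring construction with difference 1 and colour
    \<open>x mod 4\<close>. The pendant vertices \<open>x + 2\<close> and \<open>x + 3\<close> of
    the hole vertices are even in both cases, so an odd vertex \<open>y\<close> misses the colours
    of \<open>y + 1\<close> and \<open>y + 2\<close>: one comes from the pendant edge chosen by
    \<open>F y\<close>, the other from \<open>M\<close>.\<close>
  define B where "B x = (if even x
    then sun_edges (H x) (pt u x) (pt u (x + 1)) (pt u (x + 2)) e (if F (x + 1) then H (x + 2)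
        else H (x + 3))
    else sun_edges (H x) (pt u x) (pt u (x + 1)) (pt u (x + 3)) e (if F (x + 1) then pt u (x + 1
        + 2 * w) else f))" for x
  \<comment> \<open>The triangles with \<open>f\<close> use the edges of difference
    \<open>2 * w\<close> between odd vertices. The pendant edges give the lower odd vertex the
    colour of its second successor, the upper one the colour of its successor, and join
    \<open>f\<close> to an even vertex of the lower half.\<close>
  define M where "M i = sun_edges f (pt u (2 * i + 1)) (pt u (2 * i + 1 + 2 * w)) (pt u (2 * i))
    (H (2 * i + 3)) (H (2 * i + 2 + 2 * w))" for i
  have "sun_cover (\<Union>x. B x) (nat u)"
  proof (rule sun_cover_cyclic[of _ B])
    fix x :: int
    have "x mod 4 \<noteq> (x + 2) mod 4" "x mod 4 \<noteq> (x + 3) mod 4" by presburger+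
    then show "is_sun (B x)"
      unfolding B_def using u
      by (cases "even x"; cases "F (x + 1)"; simp; intro is_sunI)
        (simp_all add: pt_eq_close H_eq H_neq H_neq')
    have 4: "(x mod u + a) mod 4 = (x + a) mod 4" for a
      unfolding u(1) by (metis mod_add_left_eq mod_mult_self2_is_0 mod_mod_cancel dvd_triv_left)
    then have "H (x mod u + a) = H (x + a)" for a unfolding H_eq .
    moreover from this[of 0] have "H (x mod u) = H x" by simp
    moreover have "even (x mod u) \<longleftrightarrow> even x" using u by (simp add: dvd_mod_iff)
    moreover have "F (x mod u + a) \<longleftrightarrow> F (x + a)" for a unfolding F_def by (simp add: mod_add_left_eq)
    ultimately show "B (x mod u) = B x" unfolding B_def by (simp add: add.assoc)
  qed (use u in auto)
  \<comment> \<open>\<open>M\<close> does not have period \<open>w\<close>: passing to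
    \<open>i + w\<close> would exchange the two halves. Hence an explicit range of indices.\<close>
  moreover have "sun_cover (\<Union>i\<in>{0..<w}. M i) (nat w)"
  proof (rule sun_cover_family[of "{0..<w}" _ M])
    fix i assume "i \<in> {0..<w}"
    have "(2 * i + 3) mod 4 \<noteq> (2 * i + 2 + 2 * w) mod 4" by presburger
    then show "is_sun (M i)"
      unfolding M_def using u by (intro is_sunI) (simp add: pt_eq_close H_eq H_neq H_neq')
  qed auto
  ultimately have "sun_cover ((\<Union>x. B x) \<union> (\<Union>i\<in>{0..<w}. M i)) (nat u + nat w)" by (rule sun_cover_Un)
  moreover have "diff_edges u 1 \<union> diff_edges u (2 * w) \<union> hole_edges u t 6 \<subseteq> (\<Union>x. B x) \<union>
      (\<Union>i\<in>{0..<w}. M i)"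
  proof
    fix c assume c: "c \<in> diff_edges u 1 \<union> diff_edges u (2 * w) \<union> hole_edges u t 6"
    have shift: "pt u (x - 2 * w) = pt u (x + 2 * w)" for x
      using u by (simp add: pt_eq_iff)
    have half: "pt u (x + 2 * w + 2 * w) = pt u x" for x
      using u by (simp add: pt_eq_iff)
    have odd_cases: "\<exists>i\<in>{0..<w}. pt u x = pt u (2 * i + 1) \<and> H x = H (2 * i + 1) \<and> F x
        \<or> pt u x = pt u (2 * i + 1 + 2 * w) \<and> H x = H (2 * i + 1 + 2 * w) \<and> \<not> F x" if "odd x" for x
    proof -
      have xm: "odd (x mod u)" using that u by (simp add: dvd_mod_iff)
      have r: "0 \<le> x mod u" "x mod u < u" using u by auto
      have nx: "pt u x = pt u (x mod u)" by simp
      have hx: "H x = H (x mod u)" unfolding H_eq u(1) by (simp add: mod_mod_cancel)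
      show ?thesis
      proof (cases "F x")
        case True
        then have "x mod u = 2 * (x mod u div 2) + 1" "x mod u div 2 \<in> {0..<w}"
          using xm r unfolding F_def by auto
        then show ?thesis using nx hx True by metis
      next
        case False
        define y where "y = x mod u - 2 * w"
        have "odd y" using xm unfolding y_def by simp
        moreover have "0 \<le> y" "y < 2 * w" using r False u unfolding F_def y_def by linarith+
        ultimately have "y = 2 * (y div 2) + 1" "y div 2 \<in> {0..<w}" by auto
        moreover have "x mod u = y + 2 * w" by (simp add: y_def)
        ultimately show ?thesis using nx hx False by metis
      qed
    qed
    have even_cases: "\<exists>i\<in>{0..<w}. pt u x = pt u (2 * i)" if "even x" "F x" for x
    proof -
      have "even (x mod u)" using that u by (simp add: dvd_mod_iff)
      then have "x mod u = 2 * (x mod u div 2)" "x mod u div 2 \<in> {0..<w}"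
        using that u unfolding F_def by auto
      moreover have "pt u x = pt u (x mod u)" by simp
      ultimately show ?thesis by metis
    qed
    have BI: "c \<in> (\<Union>x. B x) \<union> (\<Union>i\<in>{0..<w}. M i)" if "c \<in> B x" for x using that by blast
    have MI: "c \<in> (\<Union>x. B x) \<union> (\<Union>i\<in>{0..<w}. M i)" if "c \<in> M i" "i \<in> {0..<w}" for i using that by
        blast
    consider x where "c = {pt u x, pt u (x + 1)}" | x where "c = {pt u x, pt u (x + 2 * w)}"
      | x i where "c = {pt u x, Inr (t + i)}" "i < 4"
      | x where "c = {pt u x, e}" | x where "c = {pt u x, f}"
    proof -
      have "i < 4 \<or> i = 4 \<or> i = 5" if "i < 6" for i :: nat using that by auto
      note six = this
      have "(\<exists>x. c = {pt u x, pt u (x + 1)}) \<or> (\<exists>x. c = {pt u x, pt u (x + 2 * w)})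
        \<or> (\<exists>x i. c = {pt u x, Inr (t + i)} \<and> i < 6)"
        using c unfolding diff_edges_def hole_edges_def by auto
      then show thesis
      proof (elim disjE exE conjE)
        fix x i assume x: "c = {pt u x, Inr (t + i)}" "i < 6"
        from six[OF x(2)] show thesis
          by (elim disjE) (use x that(3) in blast, use x that(4) e_def in blast, use x that(5)
              f_def in blast)
      qed (use that(1,2) in blast)+
    qed
    then show "c \<in> (\<Union>x. B x) \<union> (\<Union>i\<in>{0..<w}. M i)"
    proof cases
      case (1 x)
      then have "c \<in> B x" by (simp add: B_def sun_edges_def insert_commute)
      then show ?thesis by (rule BI)
    next
      case (2 x)
      show ?thesis
      proof (cases "even x")
        case True
        show ?thesis
        proof (cases "F x")
          case True
          then have "c \<in> B (x - 1)" using 2 \<open>even x\<close> by (simp add: B_def sun_edges_def)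
          then show ?thesis by (rule BI)
        next
          case False
          have "F (x + 2 * w)"
          proof -
            have eq: "x + 2 * w = (x mod u - 2 * w) + u * (x div u + 1)"
              using mult_div_mod_eq[of u x] u by (simp add: algebra_simps)
            have "(x + 2 * w) mod u = (x mod u - 2 * w) mod u"
              by (subst eq) (rule mod_mult_self2)
            also have "\<dots> = x mod u - 2 * w"
            proof (rule mod_pos_pos_trivial)
              show "0 \<le> x mod u - 2 * w" using False unfolding F_def by simp
              show "x mod u - 2 * w < u" using u pos_mod_bound[of u x] by linarith
            qed
            finally show ?thesis using u pos_mod_bound[of u x] unfolding F_def by linarith
          qed
          then have "c \<in> B (x + 2 * w - 1)" using 2 \<open>even x\<close> half[of x]
            by (simp add: B_def sun_edges_def insert_commute add.assoc)
          then show ?thesis by (rule BI)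
        qed
      next
        case False
        obtain i where i: "i \<in> {0..<w}" "pt u x = pt u (2 * i + 1) \<or> pt u x = pt u (2 * i + 1 +
            2 * w)"
          using odd_cases[OF False] by auto
        have *: "pt u (x + 2 * w) = pt u (y + 2 * w)" if "pt u x = pt u y" for y
          using that unfolding pt_eq_iff by simp
        have "c \<in> M i" using i(2) 2 *[of "2 * i + 1"] *[of "2 * i + 1 + 2 * w"] half
          unfolding M_def sun_edges_def by (elim disjE) (simp_all add: insert_commute)
        then show ?thesis using i(1) by (rule MI)
      qed
    next
      case (3 x i)
      have cH: "c = {pt u x, H j}" if "j mod 4 = int i" for j using 3 that unfolding H_def by simp
      show ?thesis
      proof (cases "even x")
        case True
        have "x mod 4 = int i \<or> (x - 1) mod 4 = int i \<or> (x - 2) mod 4 = int i \<or> (x - 3) mod 4 =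
            int i"
          using 3(2) by (intro residue_mod_4) auto
        then show ?thesis
        proof (elim disjE)
          assume "x mod 4 = int i"
          from cH[OF this] have "c \<in> B x" by (simp add: B_def sun_edges_def insert_commute)
          then show ?thesis by (rule BI)
        next
          assume "(x - 1) mod 4 = int i"
          from cH[OF this] have "c \<in> B (x - 1)" using True by (simp add: B_def sun_edges_def
              insert_commute)
          then show ?thesis by (rule BI)
        next
          assume "(x - 2) mod 4 = int i"
          from cH[OF this] have "c \<in> B (x - 2)" using True by (simp add: B_def sun_edges_def
              insert_commute)
          then show ?thesis by (rule BI)
        next
          assume "(x - 3) mod 4 = int i"
          from cH[OF this] have "c \<in> B (x - 3)" using True by (simp add: B_def sun_edges_def
              insert_commute)
          then show ?thesis by (rule BI)
        qed
      next
        case False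
        have "x mod 4 = int i \<or> (x - 1) mod 4 = int i \<or> (x + 1) mod 4 = int i \<or> (x + 2) mod 4 =
            int i"
          using residue_mod_4[of "int i" x] 3(2) mod_add_self2[of "x - 2" 4] mod_add_self2[of "x
              - 3" 4]
          by (auto simp: add.commute)
        then show ?thesis
        proof (elim disjE)
          assume "x mod 4 = int i"
          from cH[OF this] have "c \<in> B x" by (simp add: B_def sun_edges_def insert_commute)
          then show ?thesis by (rule BI)
        next
          assume "(x - 1) mod 4 = int i"
          from cH[OF this] have "c \<in> B (x - 1)" using False by (simp add: B_def sun_edges_def
              insert_commute)
          then show ?thesis by (rule BI)
        next
          assume "(x + 1) mod 4 = int i"
          note c1 = cH[OF this]
          show ?thesis
          proof (cases "F x")
            case True
            then have "c \<in> B (x - 1)" using False c1 by (simp add: B_def sun_edges_def add.commute)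
            then show ?thesis by (rule BI)
          next
            case F: False
            obtain k where k: "k \<in> {0..<w}" "pt u x = pt u (2 * k + 1 + 2 * w)" "H x = H (2 * k
                + 1 + 2 * w)"
              using odd_cases[OF False] F by auto
            have "H (x + 1) = H (2 * k + 1 + 2 * w + 1)"
              using k(3) unfolding H_eq by (intro mod_add_cong) auto
            then have "H (x + 1) = H (2 * k + 2 + 2 * w)" by (simp add: algebra_simps)
            then have "c \<in> M k" using c1 k(2) unfolding M_def sun_edges_def by simp
            then show ?thesis using k(1) by (rule MI)
          qed
        next
          assume "(x + 2) mod 4 = int i"
          note c1 = cH[OF this]
          show ?thesis
          proof (cases "F x")
            case F: True
            obtain k where k: "k \<in> {0..<w}" "pt u x = pt u (2 * k + 1)" "H x = H (2 * k + 1)"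
              using odd_cases[OF False] F by auto
            have "H (x + 2) = H (2 * k + 1 + 2)"
              using k(3) unfolding H_eq by (intro mod_add_cong) auto
            then have "H (x + 2) = H (2 * k + 3)" by (simp add: algebra_simps)
            then have "c \<in> M k" using c1 k(2) unfolding M_def sun_edges_def by simp
            then show ?thesis using k(1) by (rule MI)
          next
            case True: False
            then have "c \<in> B (x - 1)" using False c1 by (simp add: B_def sun_edges_def add.commute)
            then show ?thesis by (rule BI)
          qed
        qed
      qed
    next
      case (4 x)
      then have "c \<in> B x" by (simp add: B_def sun_edges_def insert_commute)
      then show ?thesis by (rule BI)
    next
      case (5 x)
      show ?thesis
      proof (cases "even x")
        case True
        show ?thesis
        proof (cases "F x")
          case F: True
          obtain i where "i \<in> {0..<w}" "pt u x = pt u (2 * i)" using even_cases[OF True F] by auto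
          moreover from this have "c \<in> M i" using 5 unfolding M_def sun_edges_def by (simp add:
              insert_commute)
          ultimately show ?thesis using MI by blast
        next
          case False
          then have "c \<in> B (x - 1)" using 5 True by (simp add: B_def sun_edges_def)
          then show ?thesis by (rule BI)
        qed
      next
        case False
        obtain i where i: "i \<in> {0..<w}" "pt u x = pt u (2 * i + 1) \<or> pt u x = pt u (2 * i + 1 +
            2 * w)"
          using odd_cases[OF False] by auto
        have "c \<in> M i" using i(2) 5
          unfolding M_def sun_edges_def by (elim disjE) (simp_all add: insert_commute)
        then show ?thesis using i(1) by (rule MI)
      qed
    qed
  qed
  ultimately show ?thesis by (rule sun_cover_mono) simp
qed

text \<open>The colouring \<open>c\<close> distributes the triangles on the edges between residues \<open>0\<close> and \<open>2\<close> modulo \<open>3\<close>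
  over three hole vertices; \<open>q i\<close> is the third colour besides \<open>c (i - 1)\<close> and \<open>c i\<close>.\<close>

lemma sun_cover_eight_hole_vertices:
  assumes u: "u = 3 * w" "w \<ge> 3"
  shows "sun_cover (diff_edges u 1 \<union> diff_edges u 2 \<union> hole_edges u t 8) (5 * nat w)"
proof -
  \<comment> \<open>A proper 3-colouring of the cycle of length \<open>w\<close>: alternating, with
    the third colour in the last position so that the parity of \<open>w\<close> does not
    matter.\<close>
  define c :: "int \<Rightarrow> nat" where
    "c i = (if i mod w = w - 1 then 2 else if even (i mod w) then 0 else 1)" for i
  have c_less: "c i < 3" for i by (simp add: c_def)
  have c_mod: "c (i mod w) = c i" for i by (simp add: c_def)
  have c_mod': "c (i mod w - 1) = c (i - 1)" for i by (simp add: c_def mod_diff_left_eq)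
  have c_mod'': "c (i mod w + 1) = c (i + 1)" for i by (simp add: c_def mod_add_left_eq)
  have c_neq: "c (i + 1) \<noteq> c i" for i
  proof -
    have r: "0 \<le> i mod w" "i mod w < w" using u by auto
    have "(i + 1) mod w = (i mod w + 1) mod w" by (simp add: mod_add_left_eq)
    then have "(i + 1) mod w = (if i mod w = w - 1 then 0 else i mod w + 1)"
      using r by auto
    then show ?thesis using u r by (auto simp: c_def)
  qed
  have c_neq': "c i \<noteq> c (i - 1)" for i using c_neq[of "i - 1"] by simp
  define q where "q i = 3 - c i - c (i - 1)" for i
  have q: "q i < 4" "q i < 3" "q i \<noteq> c i" "k < 4 \<Longrightarrow> k = c i \<or> k = c (i - 1) \<or> k = q i \<or> k = 3"
      for i k
  proof -
    have "c i = 0 \<or> c i = 1 \<or> c i = 2" "c (i - 1) = 0 \<or> c (i - 1) = 1 \<or> c (i - 1) = 2"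
      using c_less[of i] c_less[of "i - 1"] by linarith+
    then show "q i < 4" "q i < 3" "q i \<noteq> c i"
      "k < 4 \<Longrightarrow> k = c i \<or> k = c (i - 1) \<or> k = q i \<or> k = 3"
      using c_neq'[of i] unfolding q_def by (elim disjE; simp; linarith)+
  qed
  have q_mod: "q (i mod w) = q i" "q (i mod w + 1) = q (i + 1)" for i
    by (simp_all add: q_def c_mod c_mod' c_mod'')
  define b where "b k = (Inr (t + k) :: int + nat)" for k
  define x where "x j i = pt u (3 * i + j)" for j i :: int
  have x_mod: "x j (i mod w) = x j i" "x j (i mod w + 1) = x j (i + 1)" for j i :: int
    unfolding x_def u(1) using pt_mult_mod(1)[of 3 w i "3 + j"] pt_mult_mod(1)[of 3 w i j]
    by (simp_all add: algebra_simps)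
  \<comment> \<open>The hole vertices 0 to 3 each serve one of the edge classes between the residues
    modulo 3, and the vertices 4 to 6 share the class of \<open>B5\<close>. That leaves the edges
    from residue 2 to the next residue 0, which hang as pendant edges in \<open>B5\<close>, and the
    hole vertex 7, which lies in no triangle.\<close>
  define B1 where "B1 i = sun_edges (b 0) (x 0 i) (x 1 i) (x 2 i) (b (4 + c (i - 1))) (b (4 + c
      i))" for i
  define B2 where "B2 i = sun_edges (b 1) (x 1 i) (x 0 (i + 1)) (x 2 i) (b 7) (b (4 + q (i +
      1)))" for i
  define B3 where "B3 i = sun_edges (b 2) (x 1 i) (x 2 i) (x 0 i) (b (4 + q i)) (b 7)" for i
  define B4 where "B4 i = sun_edges (b 3) (x 2 i) (x 1 (i + 1)) (x 0 i) (b (4 + q i)) (b (4 + c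
      i))" for i
  define B5 where "B5 i = sun_edges (b (4 + c i)) (x 0 i) (x 2 i) (x 2 (i + 1)) (b 7) (x 0 (i +
      1))" for i
  note B_defs = B1_def B2_def B3_def B4_def B5_def
  have bx: "b k \<noteq> x j i" "x j i \<noteq> b k" "b k = b l \<longleftrightarrow> k = l" for k j i l by (simp_all add: b_def
      x_def)
  have dist: "distinct [x 0 i, x 1 i, x 2 i, x 0 (i + 1), x 1 (i + 1), x 2 (i + 1)]" for i
    using u by (simp add: x_def pt_eq_close)
  have suns: "is_sun (B1 i)" "is_sun (B2 i)" "is_sun (B3 i)" "is_sun (B4 i)" "is_sun (B5 i)" for i
    using dist[of i] c_neq'[of i] q(1-3)[of i] q(1-3)[of "i + 1"] c_less[of i] c_less[of "i - 1"]
    unfolding B_defs by (intro is_sunI; auto simp: bx)+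
  have w: "w > 0" using u by simp
  have per: "B1 (i mod w) = B1 i" "B2 (i mod w) = B2 i" "B3 (i mod w) = B3 i"
    "B4 (i mod w) = B4 i" "B5 (i mod w) = B5 i" for i
    unfolding B_defs by (simp_all only: x_mod c_mod c_mod' q_mod)
  have cyclic: "sun_cover (\<Union>i. B i) (nat w)"
    if "\<And>i. is_sun (B i)" "\<And>i. B (i mod w) = B i" for B :: "int \<Rightarrow> (int + nat) set set"
    using that w by (intro sun_cover_cyclic[of w B]) auto
  have covers: "sun_cover (\<Union>i. B1 i) (nat w)" "sun_cover (\<Union>i. B2 i) (nat w)"
    "sun_cover (\<Union>i. B3 i) (nat w)" "sun_cover (\<Union>i. B4 i) (nat w)" "sun_cover (\<Union>i. B5 i) (nat w)"
    by (rule cyclic; simp only: suns per)+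
  note cov = sun_cover_Un[OF sun_cover_Un[OF sun_cover_Un[OF sun_cover_Un[OF covers(1,2)]
      covers(3)] covers(4)] covers(5)]
  let ?U = "(\<Union>i. B1 i) \<union> (\<Union>i. B2 i) \<union> (\<Union>i. B3 i) \<union> (\<Union>i. B4 i) \<union> (\<Union>i. B5 i)"
  have "diff_edges u 1 \<union> diff_edges u 2 \<union> hole_edges u t 8 \<subseteq> ?U"
  proof
    fix e assume e: "e \<in> diff_edges u 1 \<union> diff_edges u 2 \<union> hole_edges u t 8"
    have "\<exists>i j. (j = 0 \<or> j = 1 \<or> j = 2) \<and> y = 3 * i + j" for y :: int
      by (rule exI[of _ "y div 3"], rule exI[of _ "y mod 3"]) presburger
    note ij = this
    have mem: "e \<in> B1 i \<Longrightarrow> e \<in> ?U" "e \<in> B2 i \<Longrightarrow> e \<in> ?U" "e \<in> B3 i \<Longrightarrow> e \<in> ?U"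
      "e \<in> B4 i \<Longrightarrow> e \<in> ?U" "e \<in> B5 i \<Longrightarrow> e \<in> ?U" for i
      using UN_I[of i UNIV e] by simp_all
    from e consider y where "e = {pt u y, pt u (y + 1)}" | y where "e = {pt u y, pt u (y + 2)}"
      | y k where "e = {pt u y, b k}" "k < 8"
      unfolding diff_edges_def hole_edges_def b_def by auto
    then show "e \<in> ?U"
    proof cases
      case (1 y)
      obtain i j where "j = 0 \<or> j = 1 \<or> j = 2" "y = 3 * i + j" using ij by blast
      then have "e = {x 0 i, x 1 i} \<or> e = {x 1 i, x 2 i} \<or> e = {x 2 i, x 0 (i + 1)}"
        using 1 by (elim disjE) (simp_all add: x_def algebra_simps)
      then have "e \<in> B1 i \<union> B3 i \<union> B5 i"
        by (elim disjE) (simp_all add: B_defs sun_edges_def)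
      then show ?thesis by (metis UnE mem)
    next
      case (2 y)
      obtain i j where "j = 0 \<or> j = 1 \<or> j = 2" "y = 3 * i + j" using ij by blast
      then have "e = {x 0 i, x 2 i} \<or> e = {x 1 i, x 0 (i + 1)} \<or> e = {x 2 i, x 1 (i + 1)}"
        using 2 by (elim disjE) (simp_all add: x_def algebra_simps)
      then have "e \<in> B5 i \<union> B2 i \<union> B4 i"
        by (elim disjE) (simp_all add: B_defs sun_edges_def)
      then show ?thesis by (metis UnE mem)
    next
      case (3 y k)
      obtain i j where "j = 0 \<or> j = 1 \<or> j = 2" "y = 3 * i + j" using ij by blast
      then have e3: "e = {x 0 i, b k} \<or> e = {x 1 i, b k} \<or> e = {x 2 i, b k}"
        using 3 by (elim disjE) (simp_all add: x_def algebra_simps)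
      have "k < 4 \<or> (\<exists>l<4. k = 4 + l)" using 3(2) by presburger
      then consider "k = 0" | "k = 1" | "k = 2" | "k = 3" | "k = 4 + c i" | "k = 4 + c (i - 1)"
        | "k = 4 + q i" | "k = 7"
      proof (elim disjE exE conjE)
        assume "k < 4"
        then have "k = 0 \<or> k = 1 \<or> k = 2 \<or> k = 3" by linarith
        then show thesis using that(1-4) by blast
      next
        fix l assume "l < 4" "k = 4 + l"
        then show thesis using q(4)[of l i] that(5-8) by auto
      qed
      then have "e \<in> B1 i \<union> B2 i \<union> B2 (i - 1) \<union> B3 i \<union> B4 i \<union> B4 (i - 1) \<union> B5 i \<union> B5 (i - 1)"
        using e3 by cases (elim disjE; simp add: B_defs sun_edges_def insert_commute)+
      then show ?thesis by (metis UnE mem)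
    qed
  qed
  then show ?thesis by (rule sun_cover_mono[OF cov]) simp
qed

section \<open>Finite pieces\<close>

type_synonym sun_list = "(nat \<times> nat \<times> nat \<times> nat \<times> nat \<times> nat) list"

text \<open>A certificate in terms of list functions, so that evaluation can check it: sextuples for
  the suns, pairs for the edges in either orientation. Only coverage is tested; disjointness follows
  from the counts.\<close>

definition pairs_covered :: "sun_list \<Rightarrow> (nat \<times> nat) list \<Rightarrow> bool" where
  "pairs_covered L P \<longleftrightarrow> list_all (\<lambda>(a, b, c, d, e, f). distinct [a, b, c, d, e, f]) L \<and>
    list_all (\<lambda>(x, y). list_ex (\<lambda>(a, b, c, d, e, f).
      list_ex (\<lambda>(v, w). v = x \<and> w = y \<or> v = y \<and> w = x)
        [(a, b), (b, c), (c, a), (a, d), (b, e), (c, f)]) L) P"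

lemma pairs_covered_sun_cover:
  assumes "pairs_covered L P" "inj f"
  shows "sun_cover ((\<lambda>(x, y). {f x, f y}) ` set P) (length L)"
proof -
  let ?B = "\<lambda>(a, b, c, d, e, g). sun_edges (f a) (f b) (f c) (f d) (f e) (f g)"
  show ?thesis
  proof (rule sun_cover_family[of "set L" _ ?B])
    fix p assume "p \<in> set L"
    moreover obtain a b c d e g where p: "p = (a, b, c, d, e, g)" by (cases p)
    ultimately have "distinct [a, b, c, d, e, g]"
      using assms(1) unfolding pairs_covered_def list_all_iff by auto
    then have "distinct [f a, f b, f c, f d, f e, f g]"
      by (simp add: inj_eq[OF assms(2)])
    then show "is_sun (?B p)" unfolding p by (auto intro!: is_sunI)
  next
    show "(\<lambda>(x, y). {f x, f y}) ` set P \<subseteq> (\<Union>p\<in>set L. ?B p)"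
    proof
      fix s assume "s \<in> (\<lambda>(x, y). {f x, f y}) ` set P"
      then obtain x y where xy: "(x, y) \<in> set P" "s = {f x, f y}" by auto
      then have "\<exists>p\<in>set L. (\<lambda>(a, b, c, d, e, g). list_ex (\<lambda>(v, w). v = x \<and> w = y \<or> v = y \<and> w = x)
          [(a, b), (b, c), (c, a), (a, d), (b, e), (c, g)]) p"
        using assms(1) unfolding pairs_covered_def list_all_iff list_ex_iff[of _ L] by blast
      then obtain a b c d e g where L: "(a, b, c, d, e, g) \<in> set L"
        and "list_ex (\<lambda>(v, w). v = x \<and> w = y \<or> v = y \<and> w = x)
          [(a, b), (b, c), (c, a), (a, d), (b, e), (c, g)]" by auto
      then have "x = a \<and> y = b \<or> x = b \<and> y = a \<or> x = b \<and> y = c \<or> x = c \<and> y = b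
        \<or> x = c \<and> y = a \<or> x = a \<and> y = c \<or> x = a \<and> y = d \<or> x = d \<and> y = a
        \<or> x = b \<and> y = e \<or> x = e \<and> y = b \<or> x = c \<and> y = g \<or> x = g \<and> y = c"
        by simp argo
      then have "s \<in> sun_edges (f a) (f b) (f c) (f d) (f e) (f g)"
        unfolding xy(2) sun_edges_def by (elim disjE conjE) (simp_all add: insert_commute)
      then show "s \<in> (\<Union>p\<in>set L. ?B p)" using L by force
    qed
  qed (simp_all add: card_length)
qed

text \<open>Numbers below 12 stand for the residues modulo 12 and \<open>12 + j\<close> for the hole
  vertex \<open>j\<close>. Difference 6 lists its edges twice, which is harmless for a
  cover.\<close>

definition circulant_pairs :: "nat list \<Rightarrow> nat \<Rightarrow> (nat \<times> nat) list" where
  "circulant_pairs D s = concat (map (\<lambda>i. map (\<lambda>d. (i, (i + d) mod 12)) D) [0..<12]) @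
    concat (map (\<lambda>i. map (\<lambda>j. (i, 12 + j)) [0..<s]) [0..<12])"

text \<open>The residues modulo \<open>12 * w\<close> fall into \<open>w\<close> cosets of the
  multiples of \<open>w\<close>. Each coset is a copy of the residues modulo 12 on which
  \<open>d * w\<close> acts as \<open>d\<close>, so one certificate is used \<open>w\<close>
  times.\<close>

lemma sun_cover_cosets:
  assumes L: "pairs_covered L (circulant_pairs D s)" and u: "u = 12 * w" "w > 0"
  shows "sun_cover ((\<Union>d\<in>set D. diff_edges u (int d * w)) \<union> hole_edges u t s) (nat w * length L)"
proof -
  define f where "f r i = (if i < 12 then pt u (r + w * int i) else Inr (t + (i - 12)))" for r i
  have "inj (f r)" for r
  proof (rule injI)
    fix i j assume ij: "f r i = f r j"
    show "i = j"
    proof (cases "i < 12 \<and> j < 12")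
      case True
      then have "\<bar>int i - int j\<bar> < 12" by auto
      then have "w * \<bar>int i - int j\<bar> < w * 12" using u by simp
      moreover have "(r + w * int i) - (r + w * int j) = w * (int i - int j)"
        by (simp add: right_diff_distrib)
      then have "\<bar>(r + w * int i) - (r + w * int j)\<bar> = w * \<bar>int i - int j\<bar>"
        using u by (simp add: abs_mult)
      ultimately have "\<bar>(r + w * int i) - (r + w * int j)\<bar> < u" using u by simp
      then show ?thesis using ij True u(2) unfolding f_def by (simp add: pt_eq_close)
    next
      case False
      then show ?thesis using ij unfolding f_def by (auto split: if_splits)
    qed
  qed
  then have "sun_cover (\<Union>r\<in>{0..<w}. (\<lambda>(x, y). {f r x, f r y}) ` set (circulant_pairs D s))
      (card {0..<w} * length L)"
    using L by (intro sun_cover_UN pairs_covered_sun_cover) auto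
  moreover have "(\<Union>d\<in>set D. diff_edges u (int d * w)) \<union> hole_edges u t s
    \<subseteq> (\<Union>r\<in>{0..<w}. (\<lambda>(x, y). {f r x, f r y}) ` set (circulant_pairs D s))"
  proof
    fix e assume e: "e \<in> (\<Union>d\<in>set D. diff_edges u (int d * w)) \<union> hole_edges u t s"
    have rep: "\<exists>r i. r \<in> {0..<w} \<and> i < 12 \<and> pt u x = f r i \<and> (\<forall>d. pt u (x + int d * w) = f r ((i
        + d) mod 12))" for x
    proof -
      define y where "y = x mod u"
      define i where "i = nat (y div w)"
      have y: "0 \<le> y" "y < u" using u by (simp_all add: y_def)
      have "0 \<le> y div w" using y u by (simp add: pos_imp_zdiv_nonneg_iff)
      moreover have "y div w < 12"
      proof (rule ccontr)
        assume "\<not> y div w < 12"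
        then have "12 * w \<le> (y div w) * w" using u by (intro mult_right_mono) auto
        moreover have "(y div w) * w \<le> y" using u div_mult_mod_eq[of y w] pos_mod_sign[of w y]
            by linarith
        ultimately show False using y u by linarith
      qed
      ultimately have i: "int i = y div w" "i < 12" by (auto simp: i_def)
      have yi: "y = y mod w + w * int i" by (simp add: i)
      have "pt u (x + int d * w) = f (y mod w) ((i + d) mod 12)" for d
      proof -
        have "pt u (x + int d * w) = pt u (y + int d * w)" by (simp add: y_def)
        also have "y + int d * w = w * (int i + int d) + y mod w" by (subst yi) (simp add:
            algebra_simps)
        also have "pt u \<dots> = pt u (w * ((int i + int d) mod 12) + y mod w)"
          using pt_mult_mod(1)[of w 12 "int i + int d" "y mod w"] by (simp add: u mult.commute)
        finally show ?thesis unfolding f_def by (simp add: zmod_int add.commute)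
      qed
      note d = this
      from this[of 0] have "pt u x = f (y mod w) i" using i(2) by simp
      then show ?thesis using d i(2) u by (intro exI[of _ "y mod w"] exI[of _ i]) auto
    qed
    from e consider x d where "d \<in> set D" "e = {pt u x, pt u (x + int d * w)}"
      | x j where "j < s" "e = {pt u x, Inr (t + j)}"
      unfolding diff_edges_def hole_edges_def by auto
    then show "e \<in> (\<Union>r\<in>{0..<w}. (\<lambda>(x, y). {f r x, f r y}) ` set (circulant_pairs D s))"
    proof cases
      case (1 x d)
      obtain r i where ri: "r \<in> {0..<w}" "i < 12" "pt u x = f r i"
        "\<forall>d. pt u (x + int d * w) = f r ((i + d) mod 12)" using rep by blast
      have "(i, (i + d) mod 12) \<in> set (circulant_pairs D s)"
        using 1 ri(2) unfolding circulant_pairs_def by auto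
      moreover have "e = {f r i, f r ((i + d) mod 12)}" using 1 ri by simp
      ultimately show ?thesis using ri(1) by (intro UN_I[of r] image_eqI[of _ _ "(i, (i + d) mod
          12)"]) auto
    next
      case (2 x j)
      obtain r i where ri: "r \<in> {0..<w}" "i < 12" "pt u x = f r i" using rep by blast
      have "(i, 12 + j) \<in> set (circulant_pairs D s)"
        using 2 ri(2) unfolding circulant_pairs_def
        by (auto intro!: disjI2 bexI[of _ i] simp del: One_nat_def)
      moreover have "e = {f r i, f r (12 + j)}" using 2 ri by (simp add: f_def)
      ultimately show ?thesis using ri(1) by (intro UN_I[of r] image_eqI[of _ _ "(i, 12 + j)"]) auto
    qed
  qed
  ultimately show ?thesis by (elim sun_cover_mono) simp_all
qed

text \<open>The lists were found with a satisfiability solver. Two differences and five hole vertices do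
  not decompose: a vertex with all three edges in triangles would need six hole vertices, and the
  number of edges leaves too few edges outside the triangles. Hence some residues take three
  differences.\<close>

lemma sun_cover_twelve_3_7:
  assumes "u = 12 * w" "w > 0"
  shows "sun_cover (diff_edges u (5 * w) \<union> diff_edges u (6 * w) \<union> hole_edges u t 7) (17 * nat w)"
proof -
  have "pairs_covered
    [(0, 5, 14, 16, 12, 4), (0, 6, 18, 12, 15, 9), (0, 7, 15, 17, 16, 1), (1, 6, 16, 14, 17, 9),
     (1, 7, 18, 12, 17, 2), (1, 8, 13, 17, 15, 6), (2, 7, 13, 16, 12, 0), (2, 8, 14, 12, 17, 7),
     (2, 9, 17, 15, 4, 5), (3, 8, 16, 15, 12, 4), (3, 9, 14, 17, 15, 10), (3, 10, 13, 12, 17, 4),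
     (4, 10, 15, 12, 16, 11), (4, 11, 18, 17, 14, 3), (5, 10, 18, 16, 12, 8),
     (5, 11, 13, 15, 17, 9), (6, 11, 12, 14, 16, 9)]
    (circulant_pairs [5, 6] 7)"
    by code_simp
  from sun_cover_cosets[OF this assms, of t] show ?thesis by (rule sun_cover_mono) auto
qed

text \<open>Savings change the number of hole vertices by multiples of 6, so a second size is needed
  to reach the other class modulo 6. Three hole vertices fewer mean \<open>36 * w\<close> edges and
  \<open>6 * w\<close> suns fewer.\<close>

lemma sun_cover_twelve_3_4:
  assumes "u = 12 * w" "w > 0"
  shows "sun_cover (diff_edges u (5 * w) \<union> diff_edges u (6 * w) \<union> hole_edges u t 4) (11 * nat w)"
proof -
  have "pairs_covered
    [(0, 7, 14, 12, 13, 9), (1, 6, 15, 8, 0, 2), (1, 7, 12, 13, 2, 5), (2, 8, 14, 13, 15, 11),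
     (3, 8, 13, 14, 12, 6), (3, 9, 15, 10, 2, 7), (4, 9, 12, 14, 13, 2), (4, 10, 15, 13, 12, 0),
     (5, 10, 14, 0, 13, 1), (5, 11, 13, 15, 4, 0), (6, 11, 12, 14, 15, 3)]
    (circulant_pairs [5, 6] 4)"
    by code_simp
  from sun_cover_cosets[OF this assms, of t] show ?thesis by (rule sun_cover_mono) auto
qed

lemma sun_cover_twelve_5_10:
  assumes "u = 12 * w" "w > 0"
  shows "sun_cover (diff_edges u (4 * w) \<union> diff_edges u (5 * w) \<union> diff_edges u (6 * w) \<union>
      hole_edges u t 10) (25 * nat w)"
proof -
  have "pairs_covered
    [(0, 4, 21, 17, 20, 1), (0, 5, 20, 6, 21, 2), (0, 7, 16, 12, 14, 1), (1, 5, 19, 15, 14, 6),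
     (1, 7, 17, 12, 20, 8), (1, 8, 13, 14, 19, 9), (2, 6, 17, 7, 20, 9), (2, 8, 14, 12, 21, 6),
     (2, 9, 16, 13, 14, 8), (2, 10, 18, 15, 21, 7), (3, 7, 15, 12, 13, 8), (3, 8, 20, 17, 0, 1),
     (3, 9, 21, 19, 1, 7), (3, 10, 14, 13, 17, 0), (3, 11, 18, 16, 20, 0), (4, 8, 18, 14, 12, 6),
     (4, 9, 19, 16, 20, 2), (4, 10, 12, 13, 19, 6), (4, 11, 15, 17, 12, 9), (5, 9, 18, 17, 12, 1),
     (5, 10, 16, 12, 13, 6), (5, 11, 13, 15, 14, 0), (6, 10, 15, 13, 20, 0),
     (6, 11, 21, 1, 16, 2), (7, 11, 19, 12, 17, 0)]
    (circulant_pairs [4, 5, 6] 10)"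
    by code_simp
  from sun_cover_cosets[OF this assms, of t] show ?thesis by (rule sun_cover_mono) auto
qed

lemma sun_cover_twelve_5_7:
  assumes "u = 12 * w" "w > 0"
  shows "sun_cover (diff_edges u (4 * w) \<union> diff_edges u (5 * w) \<union> diff_edges u (6 * w) \<union>
      hole_edges u t 7) (19 * nat w)"
proof -
  have "pairs_covered
    [(0, 5, 15, 12, 1, 9), (1, 6, 12, 15, 0, 2), (1, 7, 13, 17, 0, 3), (1, 8, 16, 14, 13, 4),
     (2, 7, 15, 13, 12, 4), (2, 8, 18, 6, 0, 1), (2, 10, 17, 16, 13, 7), (3, 8, 17, 12, 15, 0),
     (3, 9, 16, 18, 2, 0), (3, 10, 14, 7, 18, 0), (4, 8, 14, 17, 12, 7), (4, 9, 13, 18, 14, 0),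
     (4, 11, 12, 0, 15, 9), (5, 9, 18, 17, 1, 0), (5, 10, 16, 12, 4, 6), (5, 11, 14, 13, 3, 2),
     (6, 10, 15, 13, 12, 3), (6, 11, 17, 14, 16, 9), (7, 11, 18, 16, 13, 6)]
    (circulant_pairs [4, 5, 6] 7)"
    by code_simp
  from sun_cover_cosets[OF this assms, of t] show ?thesis by (rule sun_cover_mono) auto
qed

lemma sun_cover_twelve_5_4:
  assumes "u = 12 * w" "w > 0"
  shows "sun_cover (diff_edges u (4 * w) \<union> diff_edges u (5 * w) \<union> diff_edges u (6 * w) \<union>
      hole_edges u t 4) (13 * nat w)"
proof -
  have "pairs_covered
    [(0, 7, 12, 6, 2, 1), (0, 8, 15, 4, 12, 6), (1, 9, 15, 8, 2, 7), (2, 10, 14, 15, 3, 7),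
     (3, 7, 13, 15, 1, 2), (3, 8, 14, 12, 2, 0), (4, 9, 13, 15, 12, 1), (4, 11, 12, 8, 15, 6),
     (5, 9, 14, 1, 3, 4), (5, 10, 12, 0, 4, 2), (5, 11, 13, 15, 7, 0), (6, 10, 13, 1, 15, 8),
     (6, 11, 14, 2, 3, 1)]
    (circulant_pairs [4, 5, 6] 4)"
    by code_simp
  from sun_cover_cosets[OF this assms, of t] show ?thesis by (rule sun_cover_mono) auto
qed

text \<open>A hole with at most one vertex contains no edge, so one decomposition of the complete
  graph serves both \<open>n = 0\<close> and \<open>n = 1\<close>.\<close>

lemma extendable_trivial_base:
  assumes inf: "infinite (UNIV :: 'a set)" and n: "n \<le> 1" "n \<le> k"
    and L: "pairs_covered L (concat (map (\<lambda>i. map (\<lambda>j. (i, j)) [0..<i]) [0..<k]))"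
      "6 * length L \<le> k choose 2"
  shows "extendable n k TYPE('a)"
proof (rule extendable_cover[OF inf, of "{..<k}" "{..<n}"])
  have "sun_cover ((\<lambda>(x, y). {id x, id y}) ` set (concat (map (\<lambda>i. map (\<lambda>j. (i, j)) [0..<i])
      [0..<k])))
    (length L)"
    using L(1) by (rule pairs_covered_sun_cover) simp
  moreover have "hole_graph {..<k} {..<n}
    \<subseteq> (\<lambda>(x, y). {id x, id y}) ` set (concat (map (\<lambda>i. map (\<lambda>j. (i, j)) [0..<i]) [0..<k]))"
  proof
    fix e assume "e \<in> hole_graph {..<k} {..<n}"
    then obtain x y where e: "e = {x, y}" "x \<noteq> y" "x < k" "y < k"
      unfolding hole_graph_def by (auto simp: card_2_iff)
    have "{x, y} = {max x y, min x y}" "min x y < max x y" "max x y < k" using e by (auto simp: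
        max_def min_def)
    then show "e \<in> (\<lambda>(x, y). {id x, id y}) ` set (concat (map (\<lambda>i. map (\<lambda>j. (i, j)) [0..<i])
        [0..<k]))"
      unfolding e(1) by (intro image_eqI[of _ _ "(max x y, min x y)"]) (auto intro!: bexI[of _
          "max x y"])
  qed
  ultimately show "sun_cover (hole_graph {..<k} {..<n}) (length L)" by (rule sun_cover_mono) simp
  have "n choose 2 = 0" using n(1) by (simp add: binomial_eq_0)
  then show "6 * length L + (n choose 2) \<le> k choose 2" using L(2) by linarith
qed (use n in auto)

text \<open>The bound allows an order 9 system to grow only to orders from 16 on, because
  \<open>7 * 9 + 5 = 68\<close>. Orders 12 and 13 therefore need systems of their own.\<close>

lemma extendable_small_base:
  assumes inf: "infinite (UNIV :: 'a set)" and n: "n \<le> 1"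
  shows "extendable n 9 TYPE('a)" "extendable n 12 TYPE('a)" "extendable n 13 TYPE('a)"
proof -
  have "pairs_covered
    [(0, 2, 8, 5, 6, 3), (0, 4, 6, 7, 1, 8), (1, 2, 3, 0, 5, 4), (1, 5, 7, 6, 4, 2),
     (3, 5, 6, 0, 8, 7), (4, 7, 8, 2, 3, 1)]
    (concat (map (\<lambda>i. map (\<lambda>j. (i, j)) [0..<i]) [0..<9]))"
    by code_simp
  from extendable_trivial_base[OF inf n _ this] show "extendable n 9 TYPE('a)"
    using n by (simp add: choose_two)
  have "pairs_covered
    [(0, 1, 2, 6, 9, 7), (0, 9, 11, 8, 10, 1), (1, 4, 5, 3, 10, 7), (1, 6, 7, 10, 4, 0),
     (2, 5, 11, 3, 6, 10), (2, 8, 9, 4, 1, 6), (3, 4, 11, 0, 9, 6), (3, 6, 10, 5, 2, 0),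
     (3, 7, 9, 8, 11, 5), (4, 7, 8, 0, 10, 6), (5, 8, 10, 0, 11, 2)]
    (concat (map (\<lambda>i. map (\<lambda>j. (i, j)) [0..<i]) [0..<12]))"
    by code_simp
  from extendable_trivial_base[OF inf n _ this] show "extendable n 12 TYPE('a)"
    using n by (simp add: choose_two)
  have "pairs_covered
    [(0, 2, 7, 1, 9, 11), (0, 6, 10, 5, 4, 8), (0, 8, 11, 12, 3, 4), (1, 2, 8, 3, 4, 9),
     (1, 5, 9, 4, 7, 0), (1, 10, 11, 6, 2, 3), (2, 5, 11, 6, 4, 12), (3, 4, 7, 0, 8, 1),
     (3, 5, 10, 12, 6, 7), (3, 6, 9, 2, 11, 4), (4, 10, 12, 0, 9, 5), (6, 8, 12, 7, 5, 2),
     (7, 9, 12, 8, 11, 1)]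
    (concat (map (\<lambda>i. map (\<lambda>j. (i, j)) [0..<i]) [0..<13]))"
    by code_simp
  from extendable_trivial_base[OF inf n _ this] show "extendable n 13 TYPE('a)"
    using n by (simp add: choose_two)
qed

section \<open>Assembling the differences\<close>

lemma sun_cover_single_differences:
  assumes "finite A" "\<And>d. d \<in> A \<Longrightarrow> 0 < d \<and> 2 * d < u"
  shows "sun_cover ((\<Union>d\<in>A. diff_edges u d) \<union> hole_edges u t (5 * card A)) (card A * nat u)"
  using assms
proof (induction A arbitrary: t rule: finite_induct)
  case empty
  then show ?case by (simp add: sun_cover_empty)
next
  case (insert d A)
  have "sun_cover (diff_edges u d \<union> hole_edges u t 5) (nat u)"
    using insert.prems by (intro sun_cover_one_difference) auto
  moreover have "sun_cover ((\<Union>d\<in>A. diff_edges u d) \<union> hole_edges u (t + 5) (5 * card A)) (card A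
      * nat u)"
    using insert by auto
  ultimately have "sun_cover ((diff_edges u d \<union> hole_edges u t 5) \<union> ((\<Union>d\<in>A. diff_edges u d) \<union>
      hole_edges u (t + 5) (5 * card A)))
      (nat u + card A * nat u)"
    by (rule sun_cover_Un)
  then show ?case using insert.hyps hole_edges_Un[of u t 5 "5 * card A"]
    by (elim sun_cover_mono) auto
qed

lemma sun_cover_paired_differences:
  assumes "finite A" "\<And>d. d \<in> A \<Longrightarrow> 0 < d \<and> 2 * d < u"
    and "card A = x + 2 * y" "y \<le> card {d \<in> A. \<not> u dvd 5 * d}"
  shows "sun_cover ((\<Union>d\<in>A. diff_edges u d) \<union> hole_edges u t (5 * x + 4 * y)) ((x + y) * nat u)"
  using assms
proof (induction y arbitrary: A t)
  case 0
  then show ?case using sun_cover_single_differences[of A u t] by simp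
next
  case (Suc y)
  let ?G = "\<lambda>A. {d \<in> A. \<not> u dvd 5 * d}"
  have "card (?G A) > 0" using Suc.prems(4) by simp
  then obtain g where g: "g \<in> A" "\<not> u dvd 5 * g" by (auto simp: card_gt_0_iff)
  have cA: "card (A - {g}) = x + 2 * y + 1" using Suc.prems g by simp
  \<comment> \<open>One member of each pair must not have order 5. Taking the partner among the
    differences of order 5 while there are any preserves the supply of the others.\<close>
  obtain b where b: "b \<in> A" "b \<noteq> g" "y \<le> card (?G (A - {g, b}))"
  proof (cases "\<exists>b\<in>A. u dvd 5 * b")
    case True
    then obtain b where b: "b \<in> A" "u dvd 5 * b" by auto
    then have "?G (A - {g, b}) = ?G A - {g}" by auto
    moreover have "card (?G A - {g}) = card (?G A) - 1" using g by simp
    ultimately have "y \<le> card (?G (A - {g, b}))" using Suc.prems(4) by simp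
    moreover have "b \<noteq> g" using b g by auto
    ultimately show thesis using that b by blast
  next
    case False
    have "A - {g} \<noteq> {}" using cA by (metis card.empty add_is_0 one_neq_zero)
    then obtain b where b: "b \<in> A" "b \<noteq> g" by auto
    have "?G (A - {g, b}) = A - {g} - {b}" using False by auto
    moreover have "card (A - {g} - {b}) = x + 2 * y" using cA b by simp
    ultimately show thesis using that b by simp
  qed
  have "sun_cover ((\<Union>d\<in>A - {g, b}. diff_edges u d) \<union> hole_edges u (t + 4) (5 * x + 4 * y)) ((x +
      y) * nat u)"
  proof (rule Suc.IH)
    have "card (A - {g} - {b}) = x + 2 * y" using cA b by simp
    then show "card (A - {g, b}) = x + 2 * y" by (simp add: Diff_insert2 [symmetric] insert_commute)
  qed (use Suc.prems b in auto)
  moreover have "sun_cover (diff_edges u g \<union> diff_edges u b \<union> hole_edges u t 4) (nat u)"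
    using Suc.prems(2) g b by (intro sun_cover_two_differences) auto
  ultimately have "sun_cover ((\<Union>d\<in>A - {g, b}. diff_edges u d) \<union> hole_edges u (t + 4) (5 * x + 4 * y)
    \<union> (diff_edges u g \<union> diff_edges u b \<union> hole_edges u t 4)) ((x + y) * nat u + nat u)" by (rule
        sun_cover_Un)
  moreover have "hole_edges u t (5 * x + 4 * Suc y) = hole_edges u t 4 \<union> hole_edges u (t + 4) (5
      * x + 4 * y)"
    using hole_edges_Un[of u t 4 "5 * x + 4 * y"] by (simp add: algebra_simps)
  ultimately show ?case by (elim sun_cover_mono) auto
qed

text \<open>Differences of order \<open>5\<close> admit no colouring with four colours.\<close>

lemma card_fifth_differences:
  fixes u :: int
  assumes "\<And>d. d \<in> A \<Longrightarrow> 0 < d \<and> 2 * d < u" "u > 0"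
  shows "card {d \<in> A. u dvd 5 * d} \<le> 2" "\<not> 5 dvd u \<Longrightarrow> {d \<in> A. u dvd 5 * d} = {}"
proof -
  have q: "5 * d = u \<or> 5 * d = 2 * u" if "d \<in> A" "u dvd 5 * d" for d
    using that(2) assms(1)[OF that(1)] by (intro dvd_small_multiple) auto
  then have "{d \<in> A. u dvd 5 * d} \<subseteq> {u div 5, 2 * u div 5}" by force
  then have "card {d \<in> A. u dvd 5 * d} \<le> card {u div 5, 2 * u div 5}" by (intro card_mono) auto
  also have "\<dots> \<le> 2" by (simp add: card_insert_if)
  finally show "card {d \<in> A. u dvd 5 * d} \<le> 2" .
  assume "\<not> 5 dvd u"
  then have "5 * d \<noteq> u \<and> 5 * d \<noteq> 2 * u" for d by presburger
  then show "{d \<in> A. u dvd 5 * d} = {}" using q by blast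
qed

text \<open>Each pair needs four hole vertices instead of ten, so \<open>k\<close> pairs lower
  \<open>5 * card A\<close> to \<open>h\<close>. At most two differences have order 5, so
  \<open>k + 2 \<le> card A\<close> leaves one usable difference for every pair.\<close>

lemma sun_cover_differences:
  assumes A: "finite A" "\<And>d. d \<in> A \<Longrightarrow> 0 < d \<and> 2 * d < u" and u: "u > 0"
    and "5 * card A = h + 6 * k" "2 * k \<le> card A" "\<not> 5 dvd u \<or> k = 0 \<or> k + 2 \<le> card A"
  shows "sun_cover ((\<Union>d\<in>A. diff_edges u d) \<union> hole_edges u t h) ((card A - k) * nat u)"
proof -
  have "card A = card {d \<in> A. u dvd 5 * d} + card {d \<in> A. \<not> u dvd 5 * d}"
    using A(1) by (subst card_Un_disjoint[symmetric]) (auto intro: arg_cong[where f = card])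
  moreover have "{d \<in> A. u dvd 5 * d} = {}" if "\<not> 5 dvd u"
    using card_fifth_differences(2)[OF A(2) u that] .
  moreover have "card {d \<in> A. u dvd 5 * d} \<le> 2" using card_fifth_differences(1)[OF A(2) u] .
  ultimately have "k \<le> card {d \<in> A. \<not> u dvd 5 * d}" using assms(5,6) by fastforce
  moreover have "card A = (card A - 2 * k) + 2 * k" using assms(5) by simp
  ultimately have "sun_cover ((\<Union>d\<in>A. diff_edges u d) \<union> hole_edges u t (5 * (card A - 2 * k) + 4
      * k))
      ((card A - 2 * k + k) * nat u)"
    using A by (intro sun_cover_paired_differences) auto
  moreover have "5 * (card A - 2 * k) + 4 * k = h" "card A - 2 * k + k = card A - k"
    using assms(4,5) by auto
  ultimately show ?thesis by simp
qed

text \<open>The four-difference block needs two hole vertices instead of twenty and so replaces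
  three pairs, although it uses the differences of only two. This extends the range of
  \<open>k\<close> to \<open>2 * k \<le> card A + 2\<close>. Since \<open>card A\<close> is at least
  4, \<open>card A < 2 * k\<close> gives \<open>3 \<le> k\<close>, and the subtraction
  \<open>k - 3\<close> is exact.\<close>

lemma sun_cover_differences_triple:
  assumes A: "finite A" "\<And>d. d \<in> A \<Longrightarrow> 0 < d \<and> 2 * d < u" and u: "u > 0"
    and triple: "{a, b, a + b, c} \<subseteq> A" "distinct [a, b, a + b, c]"
    and k: "5 * card A = h + 6 * k" "2 * k \<le> card A + 2" "card A < 2 * k"
      "\<not> 5 dvd u \<or> k = 3 \<or> k + 3 \<le> card A"
  shows "sun_cover ((\<Union>d\<in>A. diff_edges u d) \<union> hole_edges u t h) ((card A - k) * nat u)"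
proof -
  let ?A = "A - {a, b, a + b, c}"
  have c4: "card {a, b, a + b, c} = 4" using triple(2) by simp
  have "4 \<le> card A" using card_mono[OF A(1) triple(1)] unfolding c4 .
  have cA: "card ?A = card A - 4"
    using card_Diff_subset[OF finite_subset[OF triple(1) A(1)] triple(1)] unfolding c4 .
  have "sun_cover ((\<Union>d\<in>?A. diff_edges u d) \<union> hole_edges u (t + 2) (h - 2)) ((card ?A - (k - 3))
      * nat u)"
  proof (rule sun_cover_differences)
    show "5 * card ?A = h - 2 + 6 * (k - 3)" "2 * (k - 3) \<le> card ?A"
      "\<not> 5 dvd u \<or> k - 3 = 0 \<or> k - 3 + 2 \<le> card ?A"
      using k \<open>4 \<le> card A\<close> unfolding cA by linarith+
  qed (use A u in auto)
  moreover have "sun_cover (diff_edges u a \<union> diff_edges u b \<union> diff_edges u (a + b) \<union> diff_edges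
      u c \<union> hole_edges u t 2) (nat u)"
    using triple(1) A(2)[of a] A(2)[of b] A(2)[of "a + b"] A(2)[of c]
    by (intro sun_cover_difference_triple) auto
  ultimately have "sun_cover (((\<Union>d\<in>?A. diff_edges u d) \<union> hole_edges u (t + 2) (h - 2))
      \<union> (diff_edges u a \<union> diff_edges u b \<union> diff_edges u (a + b) \<union> diff_edges u c \<union> hole_edges u
          t 2)) ((card ?A - (k - 3)) * nat u + nat u)"
    by (rule sun_cover_Un)
  moreover have "h = 2 + (h - 2)" using k \<open>4 \<le> card A\<close> by linarith
  then have "hole_edges u t h = hole_edges u t 2 \<union> hole_edges u (t + 2) (h - 2)" using
      hole_edges_Un by metis
  moreover have "(card ?A - (k - 3)) * nat u + nat u = (card A - k) * nat u"
  proof -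
    have "card ?A - (k - 3) + 1 = card A - k" using k \<open>4 \<le> card A\<close> unfolding cA by linarith
    then show ?thesis by (metis add_mult_distrib mult_1)
  qed
  ultimately show ?thesis by (elim sun_cover_mono) auto
qed

section \<open>From covers of the differences to extensions\<close>

lemma hole_graph_circulant:
  fixes u :: int
  assumes "u > 0"
  shows "hole_graph (Inl ` {0..<u} \<union> Inr ` {..<n}) (Inr ` {..<n})
    \<subseteq> (\<Union>d\<in>{d. 0 < d \<and> 2 * d \<le> u}. diff_edges u d) \<union> hole_edges u 0 n"
proof
  fix e :: "(int + nat) set"
  assume "e \<in> hole_graph (Inl ` {0..<u} \<union> Inr ` {..<n}) (Inr ` {..<n})"
  then have e: "e \<subseteq> Inl ` {0..<u} \<union> Inr ` {..<n}" "card e = 2" "\<not> e \<subseteq> Inr ` {..<n}"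
    unfolding hole_graph_def by simp_all
  obtain v w where vw: "e = {v, w}" "v \<noteq> w" using e(2) by (auto simp: card_2_iff)
  obtain p q where pq: "e = {p, q}" "p \<noteq> q" "p \<in> Inl ` {0..<u}"
    "q \<in> Inl ` {0..<u} \<union> Inr ` {..<n}"
  proof (cases "v \<in> Inl ` {0..<u}")
    case True
    then show thesis using that[of v w] vw e(1) by simp
  next
    case False
    then have "w \<in> Inl ` {0..<u}" using e(1,3) unfolding vw(1) by simp
    then show thesis using that[of w v] vw e(1) by (simp add: insert_commute)
  qed
  have pt: "Inl x = pt u x" if "x \<in> {0..<u}" for x using that unfolding pt_def by simp
  have edge: "{pt u x, pt u y} \<in> (\<Union>d\<in>{d. 0 < d \<and> 2 * d \<le> u}. diff_edges u d)"
    if xy: "0 \<le> x" "x < y" "y < u" for x y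
  proof (cases "2 * (y - x) \<le> u")
    case True
    then have "{pt u x, pt u y} \<in> diff_edges u (y - x)" "0 < y - x" using xy unfolding
        diff_edges_def by force+
    then show ?thesis using True by blast
  next
    case False
    have "pt u (y + (u - (y - x))) = pt u x" unfolding pt_def by simp
    then have "{pt u x, pt u y} \<in> diff_edges u (u - (y - x))" unfolding diff_edges_def by (auto
        simp: insert_commute intro!: exI[of _ y])
    moreover have "0 < u - (y - x)" "2 * (u - (y - x)) \<le> u" using False xy by auto
    ultimately show ?thesis by blast
  qed
  from pq(4) show "e \<in> (\<Union>d\<in>{d. 0 < d \<and> 2 * d \<le> u}. diff_edges u d) \<union> hole_edges u 0 n"
  proof
    assume "q \<in> Inl ` {0..<u}"
    then obtain x y where x: "p = pt u x" "q = pt u y" "x \<in> {0..<u}" "y \<in> {0..<u}" using pq(3)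
        pt by auto
    then have "x \<noteq> y" using pq(2) by auto
    then have "x < y \<or> y < x" by auto
    then show ?thesis using edge[of x y] edge[of y x] x pq(1) by (auto simp: insert_commute)
  next
    assume "q \<in> Inr ` {..<n}"
    then show ?thesis using pq(1,3) pt unfolding hole_edges_def by auto
  qed
qed

lemma choose_2_double: "2 * (m choose 2) + m = m * m"
  by (induction m) (auto simp: numeral_2_eq_2)

definition gap_condition :: "nat \<Rightarrow> nat \<Rightarrow> nat \<Rightarrow> bool \<Rightarrow> bool" where
  "gap_condition u F k T \<longleftrightarrow> 2 * k \<le> F \<and> (\<not> 5 dvd u \<or> k = 0 \<or> k + 2 \<le> F)
    \<or> 2 * k \<le> F + 2 \<and> F < 2 * k \<and> (\<not> 5 dvd u \<or> k = 3 \<or> k + 3 \<le> F) \<and> T"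

text \<open>The special differences \<open>D\<close> together with \<open>s\<close> hole vertices absorb the residue of the number
  of edges; \<open>k\<close> measures the distance of the remaining numbers from the extremal case
  \<open>n = 5 * card A\<close>. In \<open>gap_condition\<close>, \<open>T\<close> stands for the presence of differences
  \<open>a, b, a + b, c\<close> in \<open>A\<close>, and the disjunctions on \<open>5 dvd u\<close> leave enough differences that are
  not of order \<open>5\<close>.\<close>

lemma extendable_circulant:
  fixes n u k s N :: nat
  assumes inf: "infinite (UNIV :: 'a set)" and u: "u > 0"
    and D: "sun_cover ((\<Union>d\<in>D. diff_edges (int u) d) \<union> hole_edges (int u) 0 s) N" "12 * N \<le> r *
        u" "s \<le> n"
    and A: "finite A" "\<And>d. d \<in> A \<Longrightarrow> 0 < d \<and> 2 * d < int u" "card A = F"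
    and AD: "{d. 0 < d \<and> 2 * d \<le> int u} \<subseteq> D \<union> A"
    and k: "5 * F + s = n + 6 * k" "r + 12 * F + 1 \<le> u + 2 * n + 12 * k"
    and cond: "gap_condition u F k T" "T \<Longrightarrow> {a, b, a + b, c} \<subseteq> A \<and> distinct [a, b, a + b, c]"
  shows "extendable n (n + u) TYPE('a)"
proof -
  have k: "5 * card A + s = n + 6 * k" "r + 12 * card A + 1 \<le> u + 2 * n + 12 * k"
    using k A(3) by simp_all
  have cond: "2 * k \<le> card A \<and> (\<not> 5 dvd u \<or> k = 0 \<or> k + 2 \<le> card A)
      \<or> 2 * k \<le> card A + 2 \<and> card A < 2 * k \<and> (\<not> 5 dvd u \<or> k = 3 \<or> k + 3 \<le> card A)
        \<and> {a, b, a + b, c} \<subseteq> A \<and> distinct [a, b, a + b, c]"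
    using cond unfolding gap_condition_def A(3) by blast
  have five: "5 dvd int u \<longleftrightarrow> 5 dvd u" using int_dvd_int_iff[of 5 u] by simp
  have h: "5 * card A = (n - s) + 6 * k" using k(1) D(3) by simp
  have "sun_cover ((\<Union>d\<in>A. diff_edges (int u) d) \<union> hole_edges (int u) s (n - s)) ((card A - k) *
      nat (int u))"
    using cond
  proof
    assume "2 * k \<le> card A \<and> (\<not> 5 dvd u \<or> k = 0 \<or> k + 2 \<le> card A)"
    then show ?thesis using A(1,2) u h by (intro sun_cover_differences) (auto simp: five)
  next
    assume *: "2 * k \<le> card A + 2 \<and> card A < 2 * k \<and> (\<not> 5 dvd u \<or> k = 3 \<or> k + 3 \<le> card A)
      \<and> {a, b, a + b, c} \<subseteq> A \<and> distinct [a, b, a + b, c]"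
    show ?thesis
      by (rule sun_cover_differences_triple[of A _ a b c]) (use * A(1,2) u h in \<open>simp_all add:
          five\<close>)
  qed
  with D(1) have "sun_cover (((\<Union>d\<in>D. diff_edges (int u) d) \<union> hole_edges (int u) 0 s)
      \<union> ((\<Union>d\<in>A. diff_edges (int u) d) \<union> hole_edges (int u) s (n - s))) (N + (card A - k) * nat
          (int u))"
    by (rule sun_cover_Un)
  moreover have "hole_edges (int u) 0 n = hole_edges (int u) 0 s \<union> hole_edges (int u) s (n - s)"
    using hole_edges_Un[of "int u" 0 s "n - s"] D(3) by simp
  moreover have "(\<Union>d\<in>{d. 0 < d \<and> 2 * d \<le> int u}. diff_edges (int u) d) \<subseteq> (\<Union>d\<in>D. diff_edges (int
      u) d) \<union> (\<Union>d\<in>A. diff_edges (int u) d)"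
    using AD by blast
  ultimately have cov: "sun_cover ((\<Union>d\<in>{d. 0 < d \<and> 2 * d \<le> int u}. diff_edges (int u) d) \<union>
      hole_edges (int u) 0 n)
      (N + (card A - k) * u)"
    by (elim sun_cover_mono) auto
  show ?thesis
  proof (rule extendable_cover[OF inf, of "Inl ` {0..<int u} \<union> Inr ` {..<n}" "Inr ` {..<n}"])
    show "sun_cover (hole_graph (Inl ` {0..<int u} \<union> Inr ` {..<n}) (Inr ` {..<n})) (N + (card A
        - k) * u)"
      using cov hole_graph_circulant[of "int u" n] u by (elim sun_cover_mono) auto
    have "k \<le> card A" using cond
    proof
      assume *: "2 * k \<le> card A + 2 \<and> card A < 2 * k \<and> (\<not> 5 dvd u \<or> k = 3 \<or> k + 3 \<le> card A)
        \<and> {a, b, a + b, c} \<subseteq> A \<and> distinct [a, b, a + b, c]"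
      then have "card {a, b} \<le> card A" using A(1) by (intro card_mono) auto
      then show ?thesis using * by simp
    qed simp
    \<comment> \<open>Multiplied by \<open>u\<close>, the left side without its summand 1 bounds
      twelve times the number of suns, while \<open>u * (u - 1 + 2 * n)\<close> is twice the number
      of edges of the hole graph.\<close>
    then have "r + 12 * (card A - k) + 1 \<le> u + 2 * n" using k(2) by simp
    then have "(r + 12 * (card A - k) + 1) * u \<le> (u + 2 * n) * u" by (rule mult_right_mono) simp
    then have "12 * (N + (card A - k) * u) + u \<le> (u + 2 * n) * u" using D(2) by (simp add:
        algebra_simps)
    then show "6 * (N + (card A - k) * u) + (n choose 2) \<le> n + u choose 2"
      using choose_2_double[of n] choose_2_double[of "n + u"] by (simp add: algebra_simps)
    have "card (Inl ` {0..<int u} \<union> Inr ` {..<n} :: (int + nat) set) = card (Inl ` {0..<int u}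
        :: (int + nat) set) + card (Inr ` {..<n} :: (int + nat) set)"
      by (intro card_Un_disjoint) auto
    then show "card (Inl ` {0..<int u} \<union> Inr ` {..<n} :: (int + nat) set) = n + u"
      by (simp add: card_image)
    show "card (Inr ` {..<n} :: (int + nat) set) = n" by (simp add: card_image)
  qed auto
qed

section \<open>One extension lemma for each kind of special configuration\<close>

lemma extendable_odd:
  fixes n u h k :: nat
  assumes inf: "infinite (UNIV :: 'a set)" and u: "u = 2 * h + 1"
    and k: "5 * h = n + 6 * k" "gap_condition u h k (h \<ge> 4)"
  shows "extendable n (n + u) TYPE('a)"
  \<comment> \<open>The final numbers 1, 2, 4 instantiate \<open>a\<close>, \<open>b\<close>,
    \<open>c\<close>; the block on 1, 2, 3, 4 exists as soon as \<open>h \<ge> 4\<close>. The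
    following lemmas choose theirs outside the special differences, which explains their thresholds
    for \<open>h\<close>.\<close>
  by (rule extendable_circulant[OF inf, of u "{}" 0 0 0 n "{1..int h}" h k "h \<ge> 4" 1 2 4])
    (use u k in \<open>auto simp: sun_cover_empty\<close>)

lemma extendable_odd_one_hole_vertex:
  fixes n u h w k :: nat
  assumes inf: "infinite (UNIV :: 'a set)" and u: "u = 2 * h + 1" "u = 3 * w" "w \<ge> 3"
    and k: "5 * h = n + 4 + 6 * k" "n \<ge> 1" "gap_condition u (h - 1) k (h \<ge> 5)"
  shows "extendable n (n + u) TYPE('a)"
proof (rule extendable_circulant[OF inf, of u "{1}" 1 w 4 n "{2..int h}" "h - 1" k "h \<ge> 5" 2 3 4])
  show "sun_cover ((\<Union>d\<in>{1}. diff_edges (int u) d) \<union> hole_edges (int u) 0 1) w"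
    using sun_cover_one_hole_vertex[of "int u" "int w" 0] u by simp
  have "h \<ge> 4" using u by simp
  then show "card {2..int h} = h - 1" by simp
qed (use u k in auto)

lemma extendable_odd_eight_hole_vertices:
  fixes n u h w k :: nat
  assumes inf: "infinite (UNIV :: 'a set)" and u: "u = 2 * h + 1" "u = 3 * w" "w \<ge> 3"
    and k: "5 * h = n + 2 + 6 * k" "n \<ge> 8" "gap_condition u (h - 2) k (h \<ge> 7)"
  shows "extendable n (n + u) TYPE('a)"
proof (rule extendable_circulant[OF inf, of u "{1, 2}" 8 "5 * w" 20 n "{3..int h}" "h - 2" k "h
    \<ge> 7" 3 4 5])
  show "sun_cover ((\<Union>d\<in>{1, 2}. diff_edges (int u) d) \<union> hole_edges (int u) 0 8) (5 * w)"
    using sun_cover_eight_hole_vertices[of "int u" "int w" 0] u by (simp add: Un_assoc)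
  have "h \<ge> 4" using u by simp
  then show "card {3..int h} = h - 2" by simp
qed (use u k in auto)

lemma extendable_half_difference:
  fixes n u h w k :: nat
  assumes inf: "infinite (UNIV :: 'a set)" and u: "u = 2 * h" "u = 4 * w" "w \<ge> 2"
    and k: "5 * h = n + 4 + 6 * k" "n \<ge> 6" "gap_condition u (h - 2) k (h \<ge> 6)"
  shows "extendable n (n + u) TYPE('a)"
proof -
  have h: "h = 2 * w" using u by simp
  show ?thesis
  proof (rule extendable_circulant[OF inf, of u "{1, int h}" 6 "5 * w" 15 n "{2..int h - 1}" "h
      - 2" k "h \<ge> 6" 2 3 4])
    show "sun_cover ((\<Union>d\<in>{1, int h}. diff_edges (int u) d) \<union> hole_edges (int u) 0 6) (5 * w)"
      using sun_cover_half_difference[of "int u" "int w" 0] u(3) h by (simp add: u(2) Un_assoc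
          nat_mult_distrib)
    have "h \<ge> 4" using u by simp
    then show "card {2..int h - 1} = h - 2" by simp
  qed (use u k in auto)
qed

text \<open>The configuration for two hole vertices requires an odd difference, and 3 is the least
  one that the configuration for difference \<open>u / 2\<close> leaves free. Together they take
  \<open>5 * w + 2 * w\<close> suns.\<close>

lemma extendable_half_difference_two_hole_vertices:
  fixes n u h w k :: nat
  assumes inf: "infinite (UNIV :: 'a set)" and u: "u = 2 * h" "u = 4 * w" "w \<ge> 2"
    and k: "5 * h = n + 7 + 6 * k" "n \<ge> 8" "gap_condition u (h - 3) k (h \<ge> 7)"
  shows "extendable n (n + u) TYPE('a)"
proof -
  have h: "h = 2 * w" using u by simp
  show ?thesis
  proof (rule extendable_circulant[OF inf, of u "{1, int h, 3}" 8 "7 * w" 21 n "{2..int h - 1} -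
      {3}" "h - 3" k "h \<ge> 7" 2 4 5])
    have "sun_cover (diff_edges (int u) 1 \<union> diff_edges (int u) (2 * int w) \<union> hole_edges (int u)
        0 6) (5 * w)"
      using sun_cover_half_difference[of "int u" "int w" 0] u(3) h by (simp add: u(2) Un_assoc
          nat_mult_distrib)
    moreover have "sun_cover (diff_edges (int u) 3 \<union> hole_edges (int u) 6 2) (2 * w)"
      using u(2,3) by (intro sun_cover_mono[OF sun_cover_two_hole_vertices[of "int u" "int w" 3
          6]]) auto
    ultimately have "sun_cover ((diff_edges (int u) 1 \<union> diff_edges (int u) (2 * int w) \<union>
        hole_edges (int u) 0 6)
        \<union> (diff_edges (int u) 3 \<union> hole_edges (int u) 6 2)) (5 * w + 2 * w)" by (rule sun_cover_Un)
    then show "sun_cover ((\<Union>d\<in>{1, int h, 3}. diff_edges (int u) d) \<union> hole_edges (int u) 0 8) (7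
        * w)"
      using hole_edges_Un[of "int u" 0 6 2] by (elim sun_cover_mono) (auto simp: h)
    have "h \<ge> 4" using u by simp
    then have "card ({2..int h - 1} - {3}) = card {2..int h - 1} - 1" by (intro
        card_Diff_singleton) auto
    then show "card ({2..int h - 1} - {3}) = h - 3" by simp
  qed (use u k in auto)
qed

lemma extendable_twelve_3:
  fixes n u h w k s N :: nat
  assumes inf: "infinite (UNIV :: 'a set)" and u: "u = 2 * h" "u = 12 * w" "w \<ge> 1"
    and s: "s = 7 \<and> N = 17 \<or> s = 4 \<and> N = 11"
    and k: "5 * h + s = n + 10 + 6 * k" "n \<ge> s" "gap_condition u (h - 2) k True"
  shows "extendable n (n + u) TYPE('a)"
proof (rule extendable_circulant[OF inf, of u "{5 * int w, 6 * int w}" s "N * w" N n "{1..int h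
    - 1} - {5 * int w}" "h - 2" k True 1 2 4])
  show "sun_cover ((\<Union>d\<in>{5 * int w, 6 * int w}. diff_edges (int u) d) \<union> hole_edges (int u) 0 s)
      (N * w)"
    using s sun_cover_twelve_3_7[of "int u" "int w" 0] sun_cover_twelve_3_4[of "int u" "int w"
        0] u(2,3)
    by (elim disjE) (simp_all add: Un_assoc)
  have "card ({1..int h - 1} - {5 * int w}) = card {1..int h - 1} - 1"
    using u by (intro card_Diff_singleton) auto
  then show "card ({1..int h - 1} - {5 * int w}) = h - 2" by simp
  have "h = 6 * w" using u by simp
  moreover obtain v where "w = v + 1" using u(3) by (metis add.commute le_Suc_ex)
  ultimately have "h = 6 * v + 6" "h - 2 = 6 * v + 4" by auto
  \<comment> \<open>Writing \<open>w = v + 1\<close> turns the truncated subtraction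
    \<open>h - 2\<close> into a sum, which makes the claim linear.\<close>
  then show "N + 12 * (h - 2) + 1 \<le> u + 2 * n + 12 * k" using s k(1) u(1) by (elim disjE conjE)
      linarith+
  have "5 \<le> 5 * int w" "6 \<le> int h" using u by auto
  then show "{1, 2, 1 + 2, 4} \<subseteq> {1..int h - 1} - {5 * int w} \<and> distinct [1, 2, 1 + 2, 4 :: int]"
    by auto
qed (use u k in auto)

text \<open>For \<open>w = 1\<close> only the differences 1, 2, 3 remain outside the special ones,
  too few for the four-difference block. Hence \<open>w \<ge> 2\<close> takes the place of
  \<open>T\<close>.\<close>

lemma extendable_twelve_5:
  fixes n u h w k s N :: nat
  assumes inf: "infinite (UNIV :: 'a set)" and u: "u = 2 * h" "u = 12 * w" "w \<ge> 1"
    and s: "s = 10 \<and> N = 25 \<or> s = 7 \<and> N = 19 \<or> s = 4 \<and> N = 13"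
    and k: "5 * h + s = n + 15 + 6 * k" "n \<ge> s" "gap_condition u (h - 3) k (w \<ge> 2)"
  shows "extendable n (n + u) TYPE('a)"
proof (rule extendable_circulant[OF inf, of u "{4 * int w, 5 * int w, 6 * int w}" s "N * w" N n
      "{1..int h - 1} - {4 * int w, 5 * int w}" "h - 3" k "w \<ge> 2" 1 2 4])
  show "sun_cover ((\<Union>d\<in>{4 * int w, 5 * int w, 6 * int w}. diff_edges (int u) d) \<union> hole_edges
      (int u) 0 s) (N * w)"
    using s sun_cover_twelve_5_10[of "int u" "int w" 0] sun_cover_twelve_5_7[of "int u" "int w" 0]
      sun_cover_twelve_5_4[of "int u" "int w" 0] u(2,3)
    by (elim disjE) (simp_all add: Un_assoc)
  have "card ({1..int h - 1} - {4 * int w, 5 * int w}) = card {1..int h - 1} - card {4 * int w,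
      5 * int w}"
    using u by (intro card_Diff_subset) auto
  then show "card ({1..int h - 1} - {4 * int w, 5 * int w}) = h - 3" using u by simp
  have "h = 6 * w" using u by simp
  moreover obtain v where "w = v + 1" using u(3) by (metis add.commute le_Suc_ex)
  ultimately have "h = 6 * v + 6" "h - 3 = 6 * v + 3" by auto
  then show "N + 12 * (h - 3) + 1 \<le> u + 2 * n + 12 * k" using s k(1) u(1) by (elim disjE conjE)
      linarith+
  show "{1, 2, 1 + 2, 4} \<subseteq> {1..int h - 1} - {4 * int w, 5 * int w} \<and> distinct [1, 2, 1 + 2, 4 ::
      int]"
    if "2 \<le> w"
  proof -
    have "8 \<le> 4 * int w" "10 \<le> 5 * int w" "12 \<le> int h" using u that by auto
    then show ?thesis by auto
  qed
qed (use u k in auto)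

section \<open>Congruence classes of \<open>n\<close> and \<open>u\<close>\<close>

lemma gap_conditionI:
  assumes "2 * k \<le> F + 2" "2 * k \<le> F \<or> T"
    "5 dvd u \<Longrightarrow> k = 0 \<or> k + 3 \<le> F \<or> F < 2 * k \<and> k = 3 \<or> 2 * k \<le> F \<and> k + 2 \<le> F"
  shows "gap_condition u F k T"
  using assms unfolding gap_condition_def by (cases "2 * k \<le> F"; cases "5 dvd u") auto

lemma mod_12_cases:
  fixes n :: nat
  assumes "n mod 12 \<in> {0, 1, 4, 9}"
  obtains p where "n = 12 * p \<or> n = 12 * p + 1 \<or> n = 12 * p + 4 \<or> n = 12 * p + 9"
proof -
  have "n = 12 * (n div 12) + n mod 12" by simp
  then show thesis using assms that by (metis add_0_right insertE empty_iff)
qed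

text \<open>The residue \<open>c\<close> of \<open>u\<close> is \<open>b - a\<close> modulo 12; the
  carry \<open>e\<close> expresses this without subtraction.\<close>

lemma mod_12_step:
  fixes n u p q a b c e :: nat
  assumes "n = 12 * p + a" "n + u = 12 * q + b" "a + c = b + 12 * e" "c < 12"
  obtains t where "u = 12 * t + c"
proof -
  have "12 * p + 12 * e + u + a = 12 * q + c + a" using assms(1-3) by simp
  then have eq: "12 * p + 12 * e + u = 12 * q + c" by simp
  then have "p + e \<le> q" using assms(4) by arith
  then obtain t where "q = p + e + t" by (metis le_Suc_ex)
  then show thesis using eq that[of t] by simp
qed

text \<open>The residues of \<open>n\<close> and \<open>n + u\<close> modulo 12 determine that of
  \<open>u\<close>, and the sixteen combinations lead to nine classes, each with its own special
  configuration. The lower bound on \<open>u\<close> makes \<open>k\<close> a natural number; the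
  upper bound keeps \<open>k\<close> small enough for the gap condition.\<close>

lemma extendable_step:
  fixes n u :: nat
  assumes inf: "infinite (UNIV :: 'a set)"
    and n: "n \<ge> 9" "n mod 12 \<in> {0, 1, 4, 9}" "(n + u) mod 12 \<in> {0, 1, 4, 9}"
    and b: "2 * n + 5 \<le> 5 * u"
    and large: "u \<le> n + 3 \<or> (n, u) \<in> {(12, 16), (28, 32), (88, 92), (28, 33), (88, 93)}"
  shows "extendable n (n + u) TYPE('a)"
proof -
  have u5: "u \<ge> 5" using n b by simp
  have five: "u = 5 \<or> u = 10 \<or> u = 15 \<or> u \<ge> 20" if "5 dvd u" using that u5 by presburger
  obtain p where p: "n = 12 * p \<or> n = 12 * p + 1 \<or> n = 12 * p + 4 \<or> n = 12 * p + 9"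
    using n(2) by (rule mod_12_cases)
  obtain q where q: "n + u = 12 * q \<or> n + u = 12 * q + 1 \<or> n + u = 12 * q + 4 \<or> n + u = 12 * q + 9"
    using n(3) by (rule mod_12_cases)
  define h where "h = u div 2"
  have hu: "u = 2 * h \<or> u = 2 * h + 1" by (simp add: h_def) presburger
  have classes: "(u = 2 * h + 1 \<and> (\<exists>k. 5 * h = n + 6 * k))
    \<or> (u = 2 * h + 1 \<and> 3 dvd u \<and> (\<exists>k. 5 * h = n + 4 + 6 * k))
    \<or> (u = 2 * h + 1 \<and> 3 dvd u \<and> (\<exists>k. 5 * h = n + 2 + 6 * k))
    \<or> (4 dvd u \<and> \<not> 3 dvd u \<and> (\<exists>k. 5 * h = n + 4 + 6 * k))
    \<or> (4 dvd u \<and> \<not> 3 dvd u \<and> (\<exists>k. 5 * h = n + 7 + 6 * k))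
    \<or> (12 dvd u \<and> (\<exists>k. 5 * h = n + 3 + 6 * k))
    \<or> (12 dvd u \<and> (\<exists>k. 5 * h = n + 6 + 6 * k))
    \<or> (12 dvd u \<and> (\<exists>k. 5 * h = n + 5 + 6 * k))
    \<or> (12 dvd u \<and> (\<exists>k. 5 * h = n + 8 + 6 * k))"
    using p
  proof (elim disjE)
    assume p: "n = 12 * p"
    from q show ?thesis
    proof (elim disjE)
      assume q: "n + u = 12 * q"
      obtain t where t: "u = 12 * t"
        using mod_12_step[of n p 0 u q 0 0 0] p q by auto
      have h: "h = 6 * t" unfolding h_def t by simp
      \<comment> \<open>The offset is 6 and not 0, because \<open>5 * h = n\<close> would give
        \<open>5 * u = 2 * n\<close>, against \<open>b\<close>. In the other cases, too,
        \<open>b\<close> excludes a negative \<open>k\<close>.\<close>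
      have "\<exists>k. 5 * h = n + 6 + 6 * k" using b unfolding p t h by presburger
      moreover have "12 dvd u" unfolding t h by presburger+
      ultimately show ?thesis by blast
    next
      assume q: "n + u = 12 * q + 1"
      obtain t where t: "u = 12 * t + 1"
        using mod_12_step[of n p 0 u q 1 1 0] p q by auto
      have h: "h = 6 * t" unfolding h_def t by simp
      have "\<exists>k. 5 * h = n + 6 * k" using b unfolding p t h by presburger
      moreover have "u = 2 * h + 1" unfolding t h by presburger+
      ultimately show ?thesis by blast
    next
      assume q: "n + u = 12 * q + 4"
      obtain t where t: "u = 12 * t + 4"
        using mod_12_step[of n p 0 u q 4 4 0] p q by auto
      have h: "h = 6 * t + 2" unfolding h_def t by simp
      have "\<exists>k. 5 * h = n + 4 + 6 * k" using b unfolding p t h by presburger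
      moreover have "4 dvd u" "\<not> 3 dvd u" unfolding t h by presburger+
      ultimately show ?thesis by blast
    next
      assume q: "n + u = 12 * q + 9"
      obtain t where t: "u = 12 * t + 9"
        using mod_12_step[of n p 0 u q 9 9 0] p q by auto
      have h: "h = 6 * t + 4" unfolding h_def t by simp
      have "\<exists>k. 5 * h = n + 2 + 6 * k" using b unfolding p t h by presburger
      moreover have "u = 2 * h + 1" "3 dvd u" unfolding t h by presburger+
      ultimately show ?thesis by blast
    qed
  next
    assume p: "n = 12 * p + 1"
    from q show ?thesis
    proof (elim disjE)
      assume q: "n + u = 12 * q"
      obtain t where t: "u = 12 * t + 11"
        using mod_12_step[of n p 1 u q 0 11 1] p q by auto
      have h: "h = 6 * t + 5" unfolding h_def t by simp
      have "\<exists>k. 5 * h = n + 6 * k" using b unfolding p t h by presburger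
      moreover have "u = 2 * h + 1" unfolding t h by presburger+
      ultimately show ?thesis by blast
    next
      assume q: "n + u = 12 * q + 1"
      obtain t where t: "u = 12 * t"
        using mod_12_step[of n p 1 u q 1 0 0] p q by auto
      have h: "h = 6 * t" unfolding h_def t by simp
      have "\<exists>k. 5 * h = n + 5 + 6 * k" using b unfolding p t h by presburger
      moreover have "12 dvd u" unfolding t h by presburger+
      ultimately show ?thesis by blast
    next
      assume q: "n + u = 12 * q + 4"
      obtain t where t: "u = 12 * t + 3"
        using mod_12_step[of n p 1 u q 4 3 0] p q by auto
      have h: "h = 6 * t + 1" unfolding h_def t by simp
      have "\<exists>k. 5 * h = n + 4 + 6 * k" using b unfolding p t h by presburger
      moreover have "u = 2 * h + 1" "3 dvd u" unfolding t h by presburger+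
      ultimately show ?thesis by blast
    next
      assume q: "n + u = 12 * q + 9"
      obtain t where t: "u = 12 * t + 8"
        using mod_12_step[of n p 1 u q 9 8 0] p q by auto
      have h: "h = 6 * t + 4" unfolding h_def t by simp
      have "\<exists>k. 5 * h = n + 7 + 6 * k" using b unfolding p t h by presburger
      moreover have "4 dvd u" "\<not> 3 dvd u" unfolding t h by presburger+
      ultimately show ?thesis by blast
    qed
  next
    assume p: "n = 12 * p + 4"
    from q show ?thesis
    proof (elim disjE)
      assume q: "n + u = 12 * q"
      obtain t where t: "u = 12 * t + 8"
        using mod_12_step[of n p 4 u q 0 8 1] p q by auto
      have h: "h = 6 * t + 4" unfolding h_def t by simp
      have "\<exists>k. 5 * h = n + 4 + 6 * k" using b unfolding p t h by presburger
      moreover have "4 dvd u" "\<not> 3 dvd u" unfolding t h by presburger+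
      ultimately show ?thesis by blast
    next
      assume q: "n + u = 12 * q + 1"
      obtain t where t: "u = 12 * t + 9"
        using mod_12_step[of n p 4 u q 1 9 1] p q by auto
      have h: "h = 6 * t + 4" unfolding h_def t by simp
      have "\<exists>k. 5 * h = n + 4 + 6 * k" using b unfolding p t h by presburger
      moreover have "u = 2 * h + 1" "3 dvd u" unfolding t h by presburger+
      ultimately show ?thesis by blast
    next
      assume q: "n + u = 12 * q + 4"
      obtain t where t: "u = 12 * t"
        using mod_12_step[of n p 4 u q 4 0 0] p q by auto
      have h: "h = 6 * t" unfolding h_def t by simp
      have "\<exists>k. 5 * h = n + 8 + 6 * k" using b unfolding p t h by presburger
      moreover have "12 dvd u" unfolding t h by presburger+
      ultimately show ?thesis by blast
    next
      assume q: "n + u = 12 * q + 9"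
      obtain t where t: "u = 12 * t + 5"
        using mod_12_step[of n p 4 u q 9 5 0] p q by auto
      have h: "h = 6 * t + 2" unfolding h_def t by simp
      have "\<exists>k. 5 * h = n + 6 * k" using b unfolding p t h by presburger
      moreover have "u = 2 * h + 1" unfolding t h by presburger+
      ultimately show ?thesis by blast
    qed
  next
    assume p: "n = 12 * p + 9"
    from q show ?thesis
    proof (elim disjE)
      assume q: "n + u = 12 * q"
      obtain t where t: "u = 12 * t + 3"
        using mod_12_step[of n p 9 u q 0 3 1] p q by auto
      have h: "h = 6 * t + 1" unfolding h_def t by simp
      have "\<exists>k. 5 * h = n + 2 + 6 * k" using b unfolding p t h by presburger
      moreover have "u = 2 * h + 1" "3 dvd u" unfolding t h by presburger+
      ultimately show ?thesis by blast
    next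
      assume q: "n + u = 12 * q + 1"
      obtain t where t: "u = 12 * t + 4"
        using mod_12_step[of n p 9 u q 1 4 1] p q by auto
      have h: "h = 6 * t + 2" unfolding h_def t by simp
      have "\<exists>k. 5 * h = n + 7 + 6 * k" using b unfolding p t h by presburger
      moreover have "4 dvd u" "\<not> 3 dvd u" unfolding t h by presburger+
      ultimately show ?thesis by blast
    next
      assume q: "n + u = 12 * q + 4"
      obtain t where t: "u = 12 * t + 7"
        using mod_12_step[of n p 9 u q 4 7 1] p q by auto
      have h: "h = 6 * t + 3" unfolding h_def t by simp
      have "\<exists>k. 5 * h = n + 6 * k" using b unfolding p t h by presburger
      moreover have "u = 2 * h + 1" unfolding t h by presburger+
      ultimately show ?thesis by blast
    next
      assume q: "n + u = 12 * q + 9"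
      obtain t where t: "u = 12 * t"
        using mod_12_step[of n p 9 u q 9 0 0] p q by auto
      have h: "h = 6 * t" unfolding h_def t by simp
      have "\<exists>k. 5 * h = n + 3 + 6 * k" using b unfolding p t h by presburger
      moreover have "12 dvd u" unfolding t h by presburger+
      ultimately show ?thesis by blast
    qed
  qed
  have le5: "u \<le> n + 5" using large by auto
  have "u \<noteq> 5"
  proof
    assume u: "u = 5"
    then have "n = 9 \<or> n = 10" using n(1) b by auto
    then show False using n(2,3) u by auto
  qed
  then have five: "u = 10 \<or> u = 15 \<or> u \<ge> 20" if "5 dvd u" using five[OF that] by auto
  from classes show ?thesis
  proof (elim disjE conjE exE)
    fix k assume u: "u = 2 * h + 1" and k: "5 * h = n + 6 * k"
    have "gap_condition u h k (h \<ge> 4)"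
    proof (rule gap_conditionI)
      show "2 * k \<le> h + 2" using u k le5 by linarith
      show "2 * k \<le> h \<or> h \<ge> 4" using u k n(1) u5 by (cases "h \<ge> 4"; cases "k \<le> 1") linarith+
      assume "5 dvd u"
      from five[OF this] show "k = 0 \<or> k + 3 \<le> h \<or> h < 2 * k \<and> k = 3 \<or> 2 * k \<le> h \<and> k + 2 \<le> h"
        using u k le5 n(1) by (elim disjE) linarith+
    qed
    then show ?thesis using extendable_odd[OF inf u k] by simp
  next
    fix k assume u: "u = 2 * h + 1" "3 dvd u" and k: "5 * h = n + 4 + 6 * k"
    then obtain w where w: "u = 3 * w" by (elim dvdE)
    have h: "h \<ge> 4" using u(1) w u5 by presburger
    have "gap_condition u (h - 1) k (h \<ge> 5)"
    proof (rule gap_conditionI)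
      show "2 * k \<le> h - 1 + 2" using u k le5 by linarith
      show "2 * k \<le> h - 1 \<or> h \<ge> 5" using u k n(1) h by (cases "h \<ge> 5"; cases "k \<le> 1") linarith+
      assume "5 dvd u"
      from five[OF this] show "k = 0 \<or> k + 3 \<le> h - 1 \<or> h - 1 < 2 * k \<and> k = 3 \<or> 2 * k \<le> h - 1 \<and> k
          + 2 \<le> h - 1"
        using u k le5 n(1) by (elim disjE) linarith+
    qed
    then show ?thesis using extendable_odd_one_hole_vertex[OF inf u(1) w _ k] h u(1) w n(1) by simp
  next
    fix k assume u: "u = 2 * h + 1" "3 dvd u" and k: "5 * h = n + 2 + 6 * k"
    then obtain w where w: "u = 3 * w" by (elim dvdE)
    have h: "h \<ge> 4" using u(1) w u5 by presburger
    \<comment> \<open>None of the exceptional pairs lies in this class: those with even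
      \<open>u\<close> fail the parity, the others the congruence for \<open>k\<close>.\<close>
    have le3: "u \<le> n + 3"
      using large
    proof
      assume "(n, u) \<in> {(12, 16), (28, 32), (88, 92), (28, 33), (88, 93)}"
      then show ?thesis using u(1) k by auto presburger+
    qed
    have "gap_condition u (h - 2) k (h \<ge> 7)"
    proof (rule gap_conditionI)
      show "2 * k \<le> h - 2 + 2" using u k le3 h by linarith
      show "2 * k \<le> h - 2 \<or> h \<ge> 7"
      proof (cases "h \<ge> 7")
        case False
        then have "h = 4 \<or> h = 5 \<or> h = 6" using h by linarith
        then have "h = 4" using u by (elim disjE) auto
        moreover from this have "k \<le> 1" using k n(1) by linarith
        ultimately show ?thesis by simp
      qed simp
      assume "5 dvd u"
      from five[OF this] show "k = 0 \<or> k + 3 \<le> h - 2 \<or> h - 2 < 2 * k \<and> k = 3 \<or> 2 * k \<le> h - 2 \<and> k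
          + 2 \<le> h - 2"
      proof (elim disjE)
        assume "u = 15"
        then have "h = 7" "k \<le> 3" using u(1) k le3 by linarith+
        then show ?thesis by auto
      next
        assume "u = 10"
        then show ?thesis using u(1) by presburger
      next
        assume "20 \<le> u"
        then have "k + 3 \<le> h - 2" using u(1) k le3 by linarith
        then show ?thesis by simp
      qed
    qed
    then show ?thesis using extendable_odd_eight_hole_vertices[OF inf u(1) w _ k] h u(1) w n(1)
        by simp
  next
    fix k assume u: "4 dvd u" "\<not> 3 dvd u" and k: "5 * h = n + 4 + 6 * k"
    then obtain w where w: "u = 4 * w" by (elim dvdE)
    have h: "u = 2 * h" "h = 2 * w" "w \<ge> 2" using w u5 by (simp_all add: h_def)
    have le4: "u \<le> n + 4" using large h(1) by auto presburger+
    have w3: "w \<noteq> 3" using u(2) w by auto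
    have "gap_condition u (h - 2) k (h \<ge> 6)"
    proof (rule gap_conditionI)
      show "2 * k \<le> h - 2 + 2" using h k le4 by linarith
      show "2 * k \<le> h - 2 \<or> h \<ge> 6" using h k n(1) by (cases "w \<ge> 3"; cases "k \<le> 1") linarith+
      assume "5 dvd u"
      have "20 \<le> u" using five[OF \<open>5 dvd u\<close>] w by (elim disjE; presburger)
      then have "k + 3 \<le> h - 2" using h k le4 n(1) by linarith
      then show "k = 0 \<or> k + 3 \<le> h - 2 \<or> h - 2 < 2 * k \<and> k = 3 \<or> 2 * k \<le> h - 2 \<and> k + 2 \<le> h - 2"
          by simp
    qed
    then show ?thesis using extendable_half_difference[OF inf h(1) w h(3) k] n(1) by simp
  next
    fix k assume u: "4 dvd u" "\<not> 3 dvd u" and k: "5 * h = n + 7 + 6 * k"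
    then obtain w where w: "u = 4 * w" by (elim dvdE)
    have h: "u = 2 * h" "h = 2 * w" "w \<ge> 2" using w u5 by (simp_all add: h_def)
    have le4: "u \<le> n + 4" using large h(1) by auto presburger+
    have w3: "w \<noteq> 3" using u(2) w by auto
    have "gap_condition u (h - 3) k (h \<ge> 7)"
    proof (rule gap_conditionI)
      show "2 * k \<le> h - 3 + 2" using h k le4 by linarith
      show "2 * k \<le> h - 3 \<or> h \<ge> 7" using h k n(1) w3 by (cases "w \<ge> 4"; cases "k = 0") linarith+
      assume "5 dvd u"
      have "20 \<le> u" using five[OF \<open>5 dvd u\<close>] w by (elim disjE; presburger)
      then have "k + 3 \<le> h - 3" using h k le4 n(1) by linarith
      then show "k = 0 \<or> k + 3 \<le> h - 3 \<or> h - 3 < 2 * k \<and> k = 3 \<or> 2 * k \<le> h - 3 \<and> k + 2 \<le> h - 3"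
          by simp
    qed
    then show ?thesis using extendable_half_difference_two_hole_vertices[OF inf h(1) w h(3) k]
        n(1) by simp
  next
    fix k assume u: "12 dvd u" and k: "5 * h = n + 3 + 6 * k"
    then obtain w where w: "u = 12 * w" by (elim dvdE)
    have h: "u = 2 * h" "h = 6 * w" "w \<ge> 1" using w u5 by (simp_all add: h_def)
    have le3: "u \<le> n + 3" using large w by auto presburger+
    have "gap_condition u (h - 2) k True"
    proof (rule gap_conditionI)
      show "2 * k \<le> h - 2 + 2" using h k le3 by linarith
      assume "5 dvd u"
      have "20 \<le> u" using five[OF \<open>5 dvd u\<close>] w by (elim disjE; presburger)
      then have "k + 3 \<le> h - 2" using h k le3 n(1) by linarith
      then show "k = 0 \<or> k + 3 \<le> h - 2 \<or> h - 2 < 2 * k \<and> k = 3 \<or> 2 * k \<le> h - 2 \<and> k + 2 \<le> h - 2"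
          by simp
    qed simp
    then show ?thesis using extendable_twelve_3[OF inf h(1) w h(3), of 7 17 n k] k n(1) by simp
  next
    fix k assume u: "12 dvd u" and k: "5 * h = n + 6 + 6 * k"
    then obtain w where w: "u = 12 * w" by (elim dvdE)
    have h: "u = 2 * h" "h = 6 * w" "w \<ge> 1" using w u5 by (simp_all add: h_def)
    have le3: "u \<le> n + 3" using large w by auto presburger+
    have "gap_condition u (h - 2) k True"
    proof (rule gap_conditionI)
      show "2 * k \<le> h - 2 + 2" using h k le3 by linarith
      assume "5 dvd u"
      have "20 \<le> u" using five[OF \<open>5 dvd u\<close>] w by (elim disjE; presburger)
      then have "k + 3 \<le> h - 2" using h k le3 n(1) by linarith
      then show "k = 0 \<or> k + 3 \<le> h - 2 \<or> h - 2 < 2 * k \<and> k = 3 \<or> 2 * k \<le> h - 2 \<and> k + 2 \<le> h - 2"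
          by simp
    qed simp
    then show ?thesis using extendable_twelve_3[OF inf h(1) w h(3), of 4 11 n k] k n(1) by simp
  next
    fix k assume u: "12 dvd u" and k: "5 * h = n + 5 + 6 * k"
    then obtain w where w: "u = 12 * w" by (elim dvdE)
    have h: "u = 2 * h" "h = 6 * w" "w \<ge> 1" using w u5 by (simp_all add: h_def)
    have le3: "u \<le> n + 3" using large w by auto presburger+
    show ?thesis
    \<comment> \<open>The lists with ten and with four hole vertices both fit this class. The
      smaller one makes one of the \<open>k\<close> savings itself, so \<open>k - 1\<close> remain;
      for \<open>k = 0\<close> there is none to make and the larger one is needed.\<close>
    proof (cases k)
      case 0
      have "gap_condition u (h - 3) 0 (w \<ge> 2)" by (rule gap_conditionI) simp_all
      then show ?thesis using extendable_twelve_5[OF inf h(1) w h(3), of 10 25 n 0] k n(1) h 0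
          by simp
    next
      case (Suc j)
      have "gap_condition u (h - 3) j (w \<ge> 2)"
      proof (rule gap_conditionI)
        show "2 * j \<le> h - 3 + 2" using h k le3 Suc by linarith
        show "2 * j \<le> h - 3 \<or> w \<ge> 2" using h k n(1) Suc by (cases "w \<ge> 2"; cases "j \<le> 1") linarith+
        assume "5 dvd u"
        have "20 \<le> u" using five[OF \<open>5 dvd u\<close>] w by (elim disjE; presburger)
        then have "j + 3 \<le> h - 3" using h k le3 n(1) Suc by linarith
        then show "j = 0 \<or> j + 3 \<le> h - 3 \<or> h - 3 < 2 * j \<and> j = 3 \<or> 2 * j \<le> h - 3 \<and> j + 2 \<le> h -
            3" by simp
      qed
      then show ?thesis using extendable_twelve_5[OF inf h(1) w h(3), of 4 13 n j] k n(1) Suc by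
          simp
    qed
  next
    fix k assume u: "12 dvd u" and k: "5 * h = n + 8 + 6 * k"
    then obtain w where w: "u = 12 * w" by (elim dvdE)
    have h: "u = 2 * h" "h = 6 * w" "w \<ge> 1" using w u5 by (simp_all add: h_def)
    have le3: "u \<le> n + 3" using large w by auto presburger+
    have n10: "n \<noteq> 10" using n(2) by auto
    have "gap_condition u (h - 3) k (w \<ge> 2)"
    proof (rule gap_conditionI)
      show "2 * k \<le> h - 3 + 2" using h k le3 by linarith
      show "2 * k \<le> h - 3 \<or> w \<ge> 2"
      proof (cases "w \<ge> 2")
        case False
        then have "h = 6" using h by simp
        moreover have "k \<noteq> 2" using k n10 \<open>h = 6\<close> by auto
        moreover have "k \<le> 2" using k n(1) \<open>h = 6\<close> by linarith
        ultimately show ?thesis by simp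
      qed simp
      assume "5 dvd u"
      have "20 \<le> u" using five[OF \<open>5 dvd u\<close>] w by (elim disjE; presburger)
      then have "k + 3 \<le> h - 3" using h k le3 n(1) by linarith
      then show "k = 0 \<or> k + 3 \<le> h - 3 \<or> h - 3 < 2 * k \<and> k = 3 \<or> 2 * k \<le> h - 3 \<and> k + 2 \<le> h - 3"
          by simp
    qed
    then show ?thesis using extendable_twelve_5[OF inf h(1) w h(3), of 7 19 n k] k n(1) by simp
  qed
qed

section \<open>Induction on the order\<close>

text \<open>The congruence condition in a form suited to evaluation.\<close>

definition admissible :: "nat \<Rightarrow> bool" where
  "admissible n \<longleftrightarrow> (let r = n mod 12 in r = 0 \<or> r = 1 \<or> r = 4 \<or> r = 9)"

text \<open>The pairs of a hole size \<open>n\<close> and a number \<open>u > n + 3\<close> of new vertices for which no intermediate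
  order is available.\<close>

definition special_pair :: "nat \<Rightarrow> nat \<Rightarrow> bool" where
  "special_pair n u \<longleftrightarrow> n = 12 \<and> u = 16 \<or> n = 28 \<and> (u = 32 \<or> u = 33) \<or> n = 88 \<and> (u = 92 \<or> u = 93)"

lemma admissible_iff: "admissible n \<longleftrightarrow> n mod 12 \<in> {0, 1, 4, 9}"
  by (simp add: admissible_def Let_def)

lemma special_pair_iff:
  "special_pair n u \<longleftrightarrow> (n, u) \<in> {(12, 16), (28, 32), (88, 92), (28, 33), (88, 93)}"
  by (auto simp: special_pair_def)

text \<open>An order \<open>k\<close> that the bound permits after \<open>n\<close>, and from which
  \<open>m\<close> is close enough for a single step.\<close>

definition has_intermediate :: "nat \<Rightarrow> nat \<Rightarrow> bool" where
  "has_intermediate n m \<longleftrightarrow>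
    (\<exists>k. admissible k \<and> 7 * n + 5 \<le> 5 * k \<and> 7 * k + 5 \<le> 5 * m \<and> m \<le> 2 * k + 3)"

text \<open>The least admissible order that the bound permits after \<open>n\<close>:
  \<open>(7 * n + 9) div 5\<close> is the ceiling of \<open>(7 * n + 5) / 5\<close>. Five candidates
  suffice, the longest run of non-admissible numbers being 5, 6, 7, 8 modulo 12.\<close>

definition next_admissible :: "nat \<Rightarrow> nat" where
  "next_admissible n = hd (filter admissible [(7 * n + 9) div 5..<(7 * n + 9) div 5 + 5])"

text \<open>The finitely many pairs for which rounding to an admissible order leaves too little room
  for a general argument.\<close>

lemma small_orders:
  "list_all (\<lambda>n. list_all (\<lambda>m. special_pair n (m - n) \<or> 7 * next_admissible n + 5 \<le> 5 * m)
      (filter admissible [2 * n + 4..<2 * n + 10]))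
    (filter admissible [9..<130])"
  by code_simp

lemma admissible_window: "\<exists>i\<le>4. admissible (j + i)"
proof -
  define r where "r = j mod 12"
  have sum: "(j + i) mod 12 = (r + i) mod 12" for i unfolding r_def by (simp add: mod_add_left_eq)
  have "r < 12" by (simp add: r_def)
  then have "r = 0 \<or> r = 1 \<or> r = 2 \<or> r = 3 \<or> r = 4 \<or> r = 5 \<or> r = 6 \<or> r = 7 \<or> r = 8 \<or> r = 9
    \<or> r = 10 \<or> r = 11" by presburger
  then have "admissible (j + 0) \<or> admissible (j + 1) \<or> admissible (j + 2) \<or> admissible (j + 3)
      \<or> admissible (j + 4)"
    unfolding admissible_iff sum by (elim disjE) simp_all
  moreover have "(0 :: nat) \<le> 4" "(1 :: nat) \<le> 4" "(2 :: nat) \<le> 4" "(3 :: nat) \<le> 4" "(4 :: nat) \<le> 4"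
    by simp_all
  ultimately show ?thesis by blast
qed

lemma next_admissible: "admissible (next_admissible n)" "7 * n + 5 \<le> 5 * next_admissible n"
proof -
  let ?c = "(7 * n + 9) div 5"
  obtain i where "i \<le> 4" "admissible (?c + i)" using admissible_window by blast
  then have "?c + i \<in> set (filter admissible [?c..<?c + 5])" by simp
  then have "filter admissible [?c..<?c + 5] \<noteq> []" by (metis empty_iff empty_set)
  then have "next_admissible n \<in> set (filter admissible [?c..<?c + 5])"
    unfolding next_admissible_def by (rule hd_in_set)
  then have "admissible (next_admissible n)" "?c \<le> next_admissible n"
    unfolding set_filter set_upt by simp_all
  moreover have "7 * n + 5 \<le> 5 * ?c"
    using div_mult_mod_eq[of "7 * n + 9" 5] mod_less_divisor[of 5 "7 * n + 9"] by linarith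
  ultimately show "admissible (next_admissible n)" "7 * n + 5 \<le> 5 * next_admissible n"
    by simp_all
qed

lemma has_intermediate:
  assumes n: "n \<ge> 9" "admissible n" and m: "admissible m" "2 * n + 4 \<le> m"
  shows "special_pair n (m - n) \<or> has_intermediate n m"
\<comment> \<open>Two applications of the bound multiply the order by about 49/25, slightly less
  than 2. Rounding costs at most 39 in \<open>5 * m \<le> 7 * k + 39\<close>, and the constant is
  \<open>230 = 5 * 39 + 35\<close>.\<close>
proof (cases "49 * n + 230 \<le> 25 * m")
  case True
  \<comment> \<open>The largest order from which the bound permits \<open>m\<close>; an admissible
    \<open>k\<close> lies at most four below it.\<close>
  define j where "j = (5 * m - 5) div 7"
  have "7 * j \<le> 5 * m - 5" "5 * m - 5 < 7 * j + 7"
    using div_mult_mod_eq[of "5 * m - 5" 7] mod_less_divisor[of 7 "5 * m - 5"] unfolding j_def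
        by linarith+
  then have j: "7 * j + 5 \<le> 5 * m" "5 * m \<le> 7 * j + 11" using n(1) m(2) by linarith+
  then have "j \<ge> 4" using n(1) m(2) by linarith
  obtain i where i: "i \<le> 4" "admissible (j - 4 + i)" using admissible_window by blast
  define k where "k = j - 4 + i"
  have k: "k \<le> j" "j \<le> k + 4" using i(1) \<open>j \<ge> 4\<close> unfolding k_def by linarith+
  then have "7 * n + 5 \<le> 5 * k" "7 * k + 5 \<le> 5 * m" "m \<le> 2 * k + 3"
    using j n(1) m(2) True by linarith+
  then show ?thesis using i(2) unfolding has_intermediate_def k_def by blast
next
  case False
  define i where "i = m - 2 * n"
  have i: "m = 2 * n + i" using m(2) by (simp add: i_def)
  \<comment> \<open>The negated case condition together with \<open>m \<ge> 2 * n + 4\<close> leaves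
    only finitely many pairs.\<close>
  then have "4 \<le> i" "i < 10" "n < 130" using m(2) False by linarith+
  then have "n \<in> set (filter admissible [9..<130])"
    using n unfolding set_filter set_upt by (simp only: mem_Collect_eq atLeastLessThan_iff
        simp_thms)
  then have "list_all (\<lambda>m. special_pair n (m - n) \<or> 7 * next_admissible n + 5 \<le> 5 * m)
      (filter admissible [2 * n + 4..<2 * n + 10])"
    using small_orders unfolding list_all_iff[of _ "filter admissible [9..<130]"] by (rule
        bspec[rotated])
  moreover have "m \<in> set (filter admissible [2 * n + 4..<2 * n + 10])"
    using m \<open>i < 10\<close> i unfolding set_filter set_upt
    by (simp only: mem_Collect_eq atLeastLessThan_iff simp_thms nat_add_left_cancel_less)
  ultimately consider "special_pair n (m - n)" | "7 * next_admissible n + 5 \<le> 5 * m"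
    unfolding list_all_iff by blast
  then show ?thesis
  proof cases
    case 2
    moreover have "m \<le> 2 * next_admissible n + 3"
      using next_admissible(2)[of n] i \<open>i < 10\<close> n(1) by linarith
    ultimately show ?thesis using next_admissible[of n] unfolding has_intermediate_def by blast
  qed (rule disjI1)
qed

text \<open>Strong induction on \<open>m\<close> with \<open>n\<close> fixed: the last step, from an
  intermediate \<open>k\<close> to \<open>m\<close>, is a single extension, and \<open>k < m\<close>
  is reached by the induction hypothesis.\<close>

lemma extendable_large:
  assumes inf: "infinite (UNIV :: 'a set)"
    and "n \<ge> 9" "admissible n" "admissible m" "7 * n + 5 \<le> 5 * m"
  shows "extendable n m TYPE('a)"
  using assms(4,5)
proof (induction m rule: less_induct)
  case (less m)
  have step: "extendable k m TYPE('a)"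
    if "k \<ge> 9" "admissible k" "7 * k + 5 \<le> 5 * m" "m \<le> 2 * k + 3 \<or> special_pair k (m - k)" for k
  proof -
    have "k < m" using that by linarith
    then have km: "k + (m - k) = m" by simp
    have "extendable k (k + (m - k)) TYPE('a)"
    proof (rule extendable_step[OF inf that(1)])
      show "k mod 12 \<in> {0, 1, 4, 9}" "(k + (m - k)) mod 12 \<in> {0, 1, 4, 9}"
        using that(2) less.prems(1) unfolding km admissible_iff by simp_all
      show "2 * k + 5 \<le> 5 * (m - k)" using that(3) km by linarith
      show "m - k \<le> k + 3 \<or> (k, m - k) \<in> {(12, 16), (28, 32), (88, 92), (28, 33), (88, 93)}"
        using that(4) unfolding special_pair_iff by linarith
    qed
    then show ?thesis unfolding km .
  qed
  show ?case
  proof (cases "m \<le> 2 * n + 3 \<or> special_pair n (m - n)")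
    case True
    then show ?thesis using step[of n] assms less.prems by blast
  next
    case False
    then have "has_intermediate n m" using has_intermediate[of n m] assms less.prems by auto
    then obtain k where k: "admissible k" "7 * n + 5 \<le> 5 * k" "7 * k + 5 \<le> 5 * m" "m \<le> 2 * k + 3"
      unfolding has_intermediate_def by blast
    have "k < m" "k \<ge> 9" using k assms(2) by linarith+
    then have "extendable n k TYPE('a)" "extendable k m TYPE('a)"
      using less.IH[of k] step[of k] k by auto
    then show ?thesis by (rule extendable_trans)
  qed
qed

lemma extendable_small:
  assumes inf: "infinite (UNIV :: 'a set)" and n: "n \<le> 1" and m: "admissible m" "n \<le> m" "m \<noteq> 4"
  shows "extendable n m TYPE('a)"
proof -
  have nine: "extendable n 9 TYPE('a)" and base: "extendable n 12 TYPE('a)" "extendable n 13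
      TYPE('a)"
    using extendable_small_base[OF inf n] by auto
  consider "m \<le> 1" | "m = 9" | "m = 12" | "m = 13" | "m \<ge> 16"
  proof -
    have "m = 0 \<or> m = 1 \<or> m = 2 \<or> m = 3 \<or> m = 4 \<or> m = 5 \<or> m = 6 \<or> m = 7 \<or> m = 8 \<or> m = 9
      \<or> m = 10 \<or> m = 11 \<or> m = 12 \<or> m = 13 \<or> m = 14 \<or> m = 15 \<or> m \<ge> 16" by presburger
    then show thesis using m that unfolding admissible_iff by (elim disjE) simp_all
  qed
  then show ?thesis
  proof cases
    case 1
    \<comment> \<open>On at most one vertex there is no edge to cover.\<close>
    have "sun_cover (hole_graph {..<m} {..<n}) 0"
    proof -
      have "e \<notin> hole_graph {..<m} {..<n}" for e
        using 1 card_mono[of "{..<m}" e] unfolding hole_graph_def by auto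
      then show ?thesis using sun_cover_empty by (metis equals0I)
    qed
    moreover have "n choose 2 = 0" using n by (simp add: binomial_eq_0)
    then have "6 * 0 + (n choose 2) \<le> m choose 2" by linarith
    ultimately show ?thesis
      using m by (intro extendable_cover[OF inf, of "{..<m}" "{..<n}"]) auto
  next
    case 5
    then have "extendable 9 m TYPE('a)"
      using m by (intro extendable_large[OF inf]) (auto simp: admissible_iff)
    then show ?thesis using nine extendable_trans by blast
  qed (use nine base in auto)
qed

theorem theorem3p1:
  fixes n m :: nat
    and X :: "'a set"
    and S :: "'a ugraph set"
  assumes "infinite (UNIV :: 'a set)"
    and "n mod 12 \<in> {0, 1, 4, 9}"
    and "m mod 12 \<in> {0, 1, 4, 9}"
    and "\<not> (n \<in> {0, 1} \<and> m = 4)"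
    and "three_sun_system n X S"
  shows "(\<exists>X' S'. three_sun_system m X' S' \<and> embedded_in (X, S) (X', S'))
    \<longleftrightarrow> real m \<ge> 7 / 5 * real n + 1 \<or> m = n"
proof -
  have bound: "real m \<ge> 7 / 5 * real n + 1 \<longleftrightarrow> 7 * n + 5 \<le> 5 * m"
    by (simp add: field_simps flip: of_nat_le_iff[where ?'a = real])
  \<comment> \<open>No system has order 4, and the next residue is 9, so either the hole is trivial
    or the induction applies.\<close>
  have "n \<noteq> 4" using assms(5) no_three_sun_system_4 by auto
  then have n: "n \<le> 1 \<or> n \<ge> 9" using assms(2) by auto presburger+
  have ext: "extendable n m TYPE('a)" if "7 * n + 5 \<le> 5 * m \<or> m = n"
  proof (cases "m = n")
    case True
    then show ?thesis by (simp add: extendable_refl)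
  next
    case False
    then have le: "7 * n + 5 \<le> 5 * m" using that by simp
    show ?thesis
    proof (cases "n \<le> 1")
      case True
      \<comment> \<open>For a trivial hole the numerical bound would allow \<open>m = 4\<close>,
        where no system exists; this is the excluded case.\<close>
      then have "m \<noteq> 4" using assms(4) by auto
      then show ?thesis using extendable_small[OF assms(1) True] assms(3) le by (simp add:
          admissible_iff)
    next
      case False
      then show ?thesis
        using extendable_large[OF assms(1), of n m] n assms(2,3) le by (simp add: admissible_iff)
    qed
  qed
  show ?thesis unfolding bound
  proof
    assume "\<exists>X' S'. three_sun_system m X' S' \<and> embedded_in (X, S) (X', S')"
    then show "7 * n + 5 \<le> 5 * m \<or> m = n"
      using three_sun_system_bound[OF assms(5)] by blast
  next
    assume "7 * n + 5 \<le> 5 * m \<or> m = n"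
    from ext[OF this] show "\<exists>X' S'. three_sun_system m X' S' \<and> embedded_in (X, S) (X', S')"
      using assms(5) unfolding extendable_def by blast
  qed
qed

end
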